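(* Consider the oblique factor copula model with $G$ groups and known linking copulas: the latent vector $\boldsymbol{V}=(V_1,\dots,V_G)$ has $U(0,1)$ margins and copula density $c_{\boldsymbol{V}}$, and given $\boldsymbol{V}=\boldsymbol{v}$ the observed $U(0,1)$ variables $U_{jg}$ are independent with $U_{jg}$ having density $c_{U_{jg},V_g}(\cdot,v_g)$, so that the joint density of $\{U_{jg}: j\le d_g,\ g\le G\}$ is $$\int_0^1\cdots\int_0^1\prod_{g=1}^G\prod_{j=1}^{d_g}c_{U_{jg},V_g}(u_{jg},v_g)\,c_{\boldsymbol{V}}(\boldsymbol{v})\,dv_1\cdots dv_G .$$ Suppose there are realized infinite sequences of observed variable values $\boldsymbol{u}_1^T,\dots,\boldsymbol{u}_G^T$, $\boldsymbol{u}_g^T=(u_{1g},u_{2g},\dots)$, with latent variable values $\boldsymbol{v}^0=(v_1^0,\dots,v_G^0)^T$, from this model. Truncate the sequences to the first $d_g$ variables $\boldsymbol{u}_{g,d_g}$ for $g\in\{1,\dots,G\}$, with no $d_g$ dominating. With $D=\sum_{g=1}^Gd_g$, define the averaged negative log-likelihood in group $g$ as $$\bar L_D^{(g)}(v_g)=-D^{-1}\sum_{j=1}^{d_g}\log c_{U_{jg},V_g}(u_{jg},v_g).$$ Assume that, as $d_g\to\infty$ for all $g$, $\lim\bar L_D^{(g)}$ asymptotically has a global minimum and is strictly locally convex at the minimum. Also assume that the linking copulas have monotonic dependence and that these likelihood functions satisfy the usual regularity conditions for maximum likelihood (listed in the context). Let the proxy variables be $$\widetilde v_{g\boldsymbol{D}}=\mathrm{E}(V_g\mid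 U_{jg}=u_{jg},\ j\in\{1,\dots,d_g\})=\frac{\int_0^1v_g\prod_{j=1}^{d_g}c_{U_{jg},V_g}(u_{jg},v_g)\,dv_g}{\int_0^1\prod_{j=1}^{d_g}c_{U_{jg},V_g}(u_{jg},v_g)\,dv_g}.$$ Then, as $d_g\to\infty$, $\widetilde v_{g\boldsymbol{D}}-v_g^0=O_p(D^{-1/2})$ for $g\in\{1,2,\dots,G\}$.
   Context: The symbol $O_p$ refers to the randomness of the observed variables given the latent values $\boldsymbol{v}^0$. "No $d_g$ dominating" means the group sizes are of comparable order, i.e. each $d_g/D$ stays bounded away from $0$. Standing assumptions: (a) the bivariate linking copulas have monotonic dependence, i.e. each observed variable is monotonically related to the latent variable it is linked to; (b) for any fixed dimensions, the log-likelihood functions, with the latent variables considered as parameters to be estimated, satisfy standard regularity conditions for maximum likelihood from independent, non-identically distributed observations (such as those of Bradley and Gart, 1962), for example continuity of derivatives up to third order of the log-densities of the bivariate linking copulas with respect to the $v$'s. In their usual form such conditions also require: first and second $v$-derivatives of the densities dominated by integrable functions; third $v$-derivatives of the log-densities dominated by functions with uniformly bounded expectations; and the averaged Fisher information having a finite positive limit.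
   Formalization: The global minimum of the limit is taken to be unique and not approached elsewhere, including at the end points 0 and 1, and "strictly locally convex" is taken to mean a positive second derivative there; without either condition the claim can fail. *)

theory Defs
  imports "HOL-Probability.Probability"
begin

section \<open>The oblique factor copula model\<close>

definition unif01 :: "real measure" where
  "unif01 = restrict_space lborel {0<..<1}"

text \<open>
  Density of a bivariate copula. The normalisation in \<open>u\<close> is required for every \<open>v\<close>,
  since \<open>c \<cdot> v\<close> is used as the conditional density of \<open>U\<close> given \<open>V = v\<close>.
\<close>

definition bivariate_copula_density :: "(real \<Rightarrow> real \<Rightarrow> real) \<Rightarrow> bool" where
  "bivariate_copula_density c \<longleftrightarrow>
     (\<lambda>(u, v). c u v) \<in> borel_measurable (unif01 \<Otimes>\<^sub>M unif01) \<and>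
     (\<forall>u\<in>{0<..<1}. \<forall>v\<in>{0<..<1}. 0 \<le> c u v) \<and>
     (\<forall>v\<in>{0<..<1}. (\<integral>\<^sup>+u. ennreal (c u v) \<partial>unif01) = 1) \<and>
     (AE u in unif01. (\<integral>\<^sup>+v. ennreal (c u v) \<partial>unif01) = 1)"

definition copula_density :: "nat \<Rightarrow> ((nat \<Rightarrow> real) \<Rightarrow> real) \<Rightarrow> bool" where
  "copula_density G cV \<longleftrightarrow>
     cV \<in> borel_measurable (PiM {1..G} (\<lambda>_. unif01)) \<and>
     (\<forall>v\<in>space (PiM {1..G} (\<lambda>_. unif01)). 0 \<le> cV v) \<and>
     (\<forall>g\<in>{1..G}. distr (density (PiM {1..G} (\<lambda>_. unif01)) (\<lambda>v. ennreal (cV v)))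
                        unif01 (\<lambda>v. v g) = unif01)"

text \<open>\<open>c g j\<close> is the density of the linking copula of the \<open>j\<close>-th observed variable of group
  \<open>g\<close> with the latent variable of that group; \<open>cV\<close> is the copula density of the latent vector.\<close>

definition oblique_factor_model ::
    "nat \<Rightarrow> ((nat \<Rightarrow> real) \<Rightarrow> real) \<Rightarrow> (nat \<Rightarrow> nat \<Rightarrow> real \<Rightarrow> real \<Rightarrow> real) \<Rightarrow> bool" where
  "oblique_factor_model G cV c \<longleftrightarrow>
     copula_density G cV \<and> (\<forall>g\<in>{1..G}. \<forall>j\<ge>1. bivariate_copula_density (c g j))"

text \<open>Conditional law, given that the latent vector equals \<open>v\<close>, of all the observed variables:
  coordinate \<open>(g, j)\<close> is the \<open>j\<close>-th variable of group \<open>g\<close>.\<close>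

definition observed_law ::
    "nat \<Rightarrow> (nat \<Rightarrow> nat \<Rightarrow> real \<Rightarrow> real \<Rightarrow> real) \<Rightarrow> (nat \<Rightarrow> real) \<Rightarrow> (nat \<times> nat \<Rightarrow> real) measure" where
  "observed_law G c v =
     PiM ({1..G} \<times> {1..}) (\<lambda>(g, j). density unif01 (\<lambda>u. ennreal (c g j u (v g))))"

lemma prob_space_unif01: "prob_space unif01"
  by (rule prob_spaceI)
    (simp add: unif01_def space_restrict_space emeasure_restrict_space)

lemma linking_density_measurable:
  assumes "bivariate_copula_density c" and "v \<in> {0<..<1}"
  shows "(\<lambda>u. ennreal (c u v)) \<in> borel_measurable unif01"
proof -
  have "v \<in> space unif01"
    using assms(2) by (simp add: unif01_def space_restrict_space)
  then have "(\<lambda>u. case (u, v) of (u, v) \<Rightarrow> c u v) \<in> borel_measurable unif01"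
    using assms(1) unfolding bivariate_copula_density_def
    by (intro measurable_compose[OF measurable_Pair2']) auto
  then show ?thesis by simp
qed

lemma prob_space_linking_density:
  assumes "bivariate_copula_density c" and "v \<in> {0<..<1}"
  shows "prob_space (density unif01 (\<lambda>u. ennreal (c u v)))"
proof (rule prob_spaceI)
  have "emeasure (density unif01 (\<lambda>u. ennreal (c u v))) (space unif01) =
        (\<integral>\<^sup>+u. ennreal (c u v) \<partial>unif01)"
    using linking_density_measurable[OF assms]
    by (subst emeasure_density) (auto intro!: nn_integral_cong)
  then show "emeasure (density unif01 (\<lambda>u. ennreal (c u v)))
               (space (density unif01 (\<lambda>u. ennreal (c u v)))) = 1"
    using assms by (simp add: bivariate_copula_density_def)
qed

lemma prob_space_observed_law:
  assumes "oblique_factor_model G cV c" and "\<forall>g\<in>{1..G}. v g \<in> {0<..<1}"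
  shows "prob_space (observed_law G c v)"
  unfolding observed_law_def
  by (rule prob_space_PiM)
    (use assms in \<open>auto simp: oblique_factor_model_def intro!: prob_space_linking_density\<close>)

section \<open>Monotonic dependence and likelihood regularity\<close>

text \<open>Conditional distribution function of \<open>U\<close> given \<open>V = v\<close>.\<close>

definition cond_cdf :: "(real \<Rightarrow> real \<Rightarrow> real) \<Rightarrow> real \<Rightarrow> real \<Rightarrow> real" where
  "cond_cdf c u v = measure (density unif01 (\<lambda>x. ennreal (c x v))) {0<..u}"

text \<open>\<open>U\<close> is stochastically increasing in \<open>V\<close>, or stochastically decreasing in \<open>V\<close>.\<close>

definition monotonic_dependence :: "(real \<Rightarrow> real \<Rightarrow> real) \<Rightarrow> bool" where
  "monotonic_dependence c \<longleftrightarrow>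
     (\<forall>u\<in>{0<..<1}. antimono_on {0<..<1} (cond_cdf c u)) \<or>
     (\<forall>u\<in>{0<..<1}. mono_on {0<..<1} (cond_cdf c u))"

definition C3_on :: "real set \<Rightarrow> (real \<Rightarrow> real) \<Rightarrow> bool" where
  "C3_on S f \<longleftrightarrow>
     (\<forall>k<3. \<forall>x\<in>S. (deriv ^^ k) f differentiable (at x)) \<and> continuous_on S ((deriv ^^ 3) f)"

definition fisher_information :: "(real \<Rightarrow> real \<Rightarrow> real) \<Rightarrow> real \<Rightarrow> real" where
  "fisher_information f v =
     (\<integral>u. (deriv (\<lambda>w. ln (f u w)) v)\<^sup>2 \<partial>density unif01 (\<lambda>u. ennreal (f u v)))"

text \<open>
  Regularity conditions for maximum likelihood from the independent observations with densities
  \<open>f 1 \<cdot> v, f 2 \<cdot> v, \<dots>\<close>, where \<open>v\<close> in the open unit interval is the parameter and \<open>v0\<close> its true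
  value. As in Bradley and Gart (1962), the dominating functions do not depend on the parameter,
  which ranges over the whole parameter space. Positivity is needed for the log-densities to exist
  (\<open>ln\<close> is total).
\<close>

definition mle_regular :: "(nat \<Rightarrow> real \<Rightarrow> real \<Rightarrow> real) \<Rightarrow> real \<Rightarrow> bool" where
  "mle_regular f v0 \<longleftrightarrow>
     (\<forall>j\<ge>1. \<forall>u\<in>{0<..<1}.
        (\<forall>v\<in>{0<..<1}. 0 < f j u v) \<and> C3_on {0<..<1} (\<lambda>v. ln (f j u v))) \<and>
     (\<exists>F1 F2. \<forall>j\<ge>1. integrable unif01 (F1 j) \<and> integrable unif01 (F2 j) \<and>
        (\<forall>u\<in>{0<..<1}. \<forall>v\<in>{0<..<1}.
           \<bar>deriv (f j u) v\<bar> \<le> F1 j u \<and> \<bar>(deriv ^^ 2) (f j u) v\<bar> \<le> F2 j u)) \<and>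
     (\<exists>H K. \<forall>j\<ge>1.
        integrable (density unif01 (\<lambda>u. ennreal (f j u v0))) (H j) \<and>
        (\<integral>u. H j u \<partial>density unif01 (\<lambda>u. ennreal (f j u v0))) \<le> K \<and>
        (\<forall>u\<in>{0<..<1}. \<forall>v\<in>{0<..<1}. \<bar>(deriv ^^ 3) (\<lambda>w. ln (f j u w)) v\<bar> \<le> H j u)) \<and>
     (\<forall>j\<ge>1. integrable (density unif01 (\<lambda>u. ennreal (f j u v0)))
               (\<lambda>u. (deriv (\<lambda>w. ln (f j u w)) v0)\<^sup>2)) \<and>
     (\<exists>I>0. (\<lambda>n. (\<Sum>j=1..n. fisher_information (f j) v0) / real n) \<longlonglongrightarrow> I)"

section \<open>Averaged negative log-likelihood and its limit\<close>

definition total_dim :: "nat \<Rightarrow> (nat \<Rightarrow> nat) \<Rightarrow> nat" where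
  "total_dim G d = (\<Sum>g=1..G. d g)"

definition avg_neg_loglik ::
    "nat \<Rightarrow> (nat \<Rightarrow> nat \<Rightarrow> real \<Rightarrow> real \<Rightarrow> real) \<Rightarrow> (nat \<Rightarrow> nat) \<Rightarrow> nat \<Rightarrow>
     (nat \<times> nat \<Rightarrow> real) \<Rightarrow> real \<Rightarrow> real" where
  "avg_neg_loglik G c d g u v =
     - (\<Sum>j=1..d g. ln (c g j (u (g, j)) v)) / real (total_dim G d)"

definition converges_in_prob :: "'a measure \<Rightarrow> (nat \<Rightarrow> 'a \<Rightarrow> real) \<Rightarrow> real \<Rightarrow> bool" where
  "converges_in_prob M X x \<longleftrightarrow>
     (\<forall>n. X n \<in> borel_measurable M) \<and>
     (\<forall>\<epsilon>>0. (\<lambda>n. measure M {\<omega> \<in> space M. \<bar>X n \<omega> - x\<bar> > \<epsilon>}) \<longlonglongrightarrow> 0)"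

definition is_bigO_prob :: "'a measure \<Rightarrow> (nat \<Rightarrow> 'a \<Rightarrow> real) \<Rightarrow> (nat \<Rightarrow> real) \<Rightarrow> bool" where
  "is_bigO_prob M X a \<longleftrightarrow>
     (\<forall>n. X n \<in> borel_measurable M) \<and>
     (\<forall>\<epsilon>>0. \<exists>B. \<forall>\<^sub>F n in sequentially.
        measure M {\<omega> \<in> space M. \<bar>X n \<omega>\<bar> > B * a n} \<le> \<epsilon>)"

text \<open>
  \<open>x0\<close> is the global minimum on the open unit interval, and the infimum is not approached away from
  it. For a function extending continuously to the closed unit interval this says that \<open>x0\<close> is the
  unique minimum of the extension: a competing minimum at an end point is excluded as well.
\<close>

definition global_min_at :: "(real \<Rightarrow> real) \<Rightarrow> real \<Rightarrow> bool" where
  "global_min_at l x0 \<longleftrightarrow>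
     x0 \<in> {0<..<1} \<and>
     (\<forall>\<epsilon>>0. \<exists>\<eta>>0. \<forall>x\<in>{0<..<1}. \<bar>x - x0\<bar> \<ge> \<epsilon> \<longrightarrow> l x \<ge> l x0 + \<eta>)"

text \<open>Strict local convexity at a point in the sense of a positive second derivative.\<close>

definition strictly_locally_convex_at :: "(real \<Rightarrow> real) \<Rightarrow> real \<Rightarrow> bool" where
  "strictly_locally_convex_at l x0 \<longleftrightarrow>
     (\<exists>l' k. (\<forall>\<^sub>F x in nhds x0. (l has_real_derivative l' x) (at x)) \<and>
             (l' has_real_derivative k) (at x0) \<and> k > 0)"

section \<open>Proxy variables\<close>

text \<open>
  Conditional expectation of the latent variable of group \<open>g\<close> given the first \<open>n\<close> observed
  variables of that group, computed from their joint density with the latent variable, which is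
  uniform on the unit interval.
\<close>

definition proxy ::
    "(nat \<Rightarrow> nat \<Rightarrow> real \<Rightarrow> real \<Rightarrow> real) \<Rightarrow> nat \<Rightarrow> nat \<Rightarrow> (nat \<times> nat \<Rightarrow> real) \<Rightarrow> real" where
  "proxy c g n u =
     (\<integral>v. v * (\<Prod>j=1..n. c g j (u (g, j)) v) \<partial>unif01) /
     (\<integral>v. (\<Prod>j=1..n. c g j (u (g, j)) v) \<partial>unif01)"

end

theory Submission
  imports Defs
begin

text \<open>
  Write \<open>L\<close> for the log-likelihood of one group. The likelihood ratio \<open>exp (L v - L v0)\<close> has
  expectation \<open>1\<close>, so by Markov's inequality the limit of \<open>- L / D\<close> is minimal at \<open>v0\<close>. With high
  probability the score at \<open>v0\<close> is \<open>O(sqrt D)\<close> (its variance is the summed Fisher information) and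
  the third derivative of \<open>L\<close> is \<open>O(D)\<close> uniformly in \<open>v\<close>. Together with convergence of \<open>- L / D\<close> at
  finitely many points this yields \<open>L v - L v0 \<le> C - m D (v - v0)\<^sup>2\<close> on the whole unit
  interval, whereas \<open>L v - L v0\<close> is bounded below at distance \<open>O(1 / sqrt D)\<close> from \<open>v0\<close>. The proxy is
  the mean of the density proportional to \<open>exp L\<close>, which therefore is within \<open>O(1 / sqrt D)\<close>
  of \<open>v0\<close>. No law of large numbers for the second derivatives is needed: they are read off from
  the values of \<open>- L / D\<close>.
\<close>

section \<open>Concentration of the posterior mean\<close>

lemma space_unif01 [simp]: "space unif01 = {0<..<1}"
  by (simp add: unif01_def space_restrict_space)

section \<open>Growth of the limit function at its minimum\<close>

text \<open>The derivative vanishes at an interior minimum, so a positive second derivative forces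
  quadratic growth nearby. Points to the right of \<open>x0\<close> are enough: later the likelihood
  is compared with \<open>l\<close> at a single such point.\<close>

lemma convex_min_growth:
  assumes convex: "strictly_locally_convex_at l x0"
    and x0: "x0 \<in> {0<..<1}" and min: "\<And>x. x \<in> {0<..<1} \<Longrightarrow> l x0 \<le> l x"
  obtains \<kappa> where "\<kappa> > 0"
    "\<And>\<rho>. \<rho> > 0 \<Longrightarrow> \<exists>t>0. t < \<rho> \<and> x0 + t < 1 \<and> l (x0 + t) - l x0 \<ge> \<kappa> * t\<^sup>2"
proof -
  from convex obtain l' k where
    l': "\<forall>\<^sub>F x in nhds x0. (l has_real_derivative l' x) (at x)"
    and k: "(l' has_real_derivative k) (at x0)" "k > 0"
    by (auto simp: strictly_locally_convex_at_def)
  from l' obtain d1 where d1: "d1 > 0" "\<And>x. dist x x0 < d1 \<Longrightarrow> (l has_real_derivative l' x) (at x)"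
    by (auto simp: eventually_nhds_metric)
  have "l' x0 = 0"
  proof (rule DERIV_local_min)
    show "(l has_real_derivative l' x0) (at x0)" using d1 by simp
    show "0 < min x0 (1 - x0)" using x0 by simp
    show "\<forall>y. \<bar>x0 - y\<bar> < min x0 (1 - x0) \<longrightarrow> l x0 \<le> l y"
      by (intro allI impI min) auto
  qed
  have "(\<lambda>h. (l' (x0 + h) - l' x0) / h) \<midarrow>0\<rightarrow> k"
    using k(1) by (simp add: DERIV_def)
  from tendstoD[OF this, of "k/2"] \<open>k > 0\<close> obtain d2 where d2: "d2 > 0"
    "\<And>h. h \<noteq> 0 \<Longrightarrow> \<bar>h\<bar> < d2 \<Longrightarrow> \<bar>l' (x0 + h) / h - k\<bar> < k/2"
    by (auto simp: eventually_at dist_real_def \<open>l' x0 = 0\<close>)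
  have slope: "l' (x0 + h) \<ge> k / 2 * h" if "0 \<le> h" "h < d2" for h
  proof (cases "h = 0")
    case False
    then have "l' (x0 + h) / h > k / 2"
      using d2(2)[of h] that False abs_ge_minus_self[of "l' (x0 + h) / h - k"] by linarith
    then show ?thesis using False that by (simp add: field_simps)
  qed (simp add: \<open>l' x0 = 0\<close>)
  show ?thesis
  proof
    show "k / 4 > 0" using k by simp
    fix \<rho> :: real assume "\<rho> > 0"
    define t where "t = min (min d1 d2) (min \<rho> (1 - x0)) / 2"
    have t: "0 < t" "t < d1" "t < d2" "t < \<rho>" "x0 + t < 1"
      using d1(1) d2(1) \<open>\<rho> > 0\<close> x0 unfolding t_def min_def
      by (auto simp: field_simps split: if_splits)
    \<comment> \<open>Subtracting the parabola leaves a function with nonnegative derivative from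
      \<open>x0\<close> to \<open>x0 + t\<close>.\<close>
    have "l x0 - k / 4 * (x0 - x0)\<^sup>2 \<le> l (x0 + t) - k / 4 * (x0 + t - x0)\<^sup>2"
    proof (rule DERIV_nonneg_imp_nondecreasing[where f = "\<lambda>x. l x - k / 4 * (x - x0)\<^sup>2"])
      fix x assume x: "x0 \<le> x" "x \<le> x0 + t"
      have "((\<lambda>x. l x - k / 4 * (x - x0)\<^sup>2) has_real_derivative l' x - k / 2 * (x - x0)) (at x)"
        by (rule derivative_eq_intros d1(2) refl | use x t in \<open>simp add: dist_real_def field_simps\<close>)+
      moreover have "l' x - k / 2 * (x - x0) \<ge> 0"
        using slope[of "x - x0"] x t by simp
      ultimately show "\<exists>y. ((\<lambda>x. l x - k / 4 * (x - x0)\<^sup>2) has_real_derivative y) (at x) \<and> 0 \<le> y"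
        by blast
    qed (use t in simp)
    then show "\<exists>t>0. t < \<rho> \<and> x0 + t < 1 \<and> l (x0 + t) - l x0 \<ge> k / 4 * t\<^sup>2"
      using t by auto
  qed
qed

section \<open>Mean of a density below a Gaussian envelope\<close>

text \<open>Up to its normalising factor the integrand is the normal density of variance
  \<open>1 / (2 * b)\<close> times \<open>\<bar>x - m\<bar>\<close>, so this is a first absolute
  normal moment.\<close>

lemma lborel_integral_abs_gaussian:
  fixes b m :: real
  assumes "b > 0"
  shows "has_bochner_integral lborel (\<lambda>x. \<bar>x - m\<bar> * exp (- (b * (x - m)\<^sup>2))) (1 / b)"
proof -
  define s where "s = sqrt (1 / (2 * b))"
  have s: "s > 0" "s\<^sup>2 = 1 / (2 * b)" using assms by (simp_all add: s_def)
  have moment: "has_bochner_integral lborel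
      (\<lambda>x. sqrt (2 * pi * s\<^sup>2) * (normal_density m s x * \<bar>x - m\<bar> ^ (2 * 0 + 1)))
      (sqrt (2 * pi * s\<^sup>2) * (2 ^ 0 * s ^ (2 * 0 + 1) * fact 0 * sqrt (2 / pi)))"
    using normal_moment_abs_odd[OF s(1)] by (rule has_bochner_integral_mult_right)
  have val: "sqrt (2 * pi * s\<^sup>2) * (2 ^ 0 * s ^ (2 * 0 + 1) * fact 0 * sqrt (2 / pi)) = 1 / b"
  proof -
    have "sqrt (2 * pi * s\<^sup>2) * sqrt (2 / pi) = 2 * s"
    proof -
      have "sqrt (2 * pi * s\<^sup>2) * sqrt (2 / pi) = sqrt ((2 * s)\<^sup>2)"
        unfolding real_sqrt_mult[symmetric] by (simp add: power2_eq_square)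
      also have "\<dots> = 2 * s" using s(1) by (intro real_sqrt_unique) auto
      finally show ?thesis .
    qed
    then have "sqrt (2 * pi * s\<^sup>2) * (2 ^ 0 * s ^ (2 * 0 + 1) * fact 0 * sqrt (2 / pi)) = 2 * s\<^sup>2"
      by (simp add: power2_eq_square)
    then show ?thesis using s(2) by simp
  qed
  have integrand: "sqrt (2 * pi * s\<^sup>2) * (normal_density m s x * \<bar>x - m\<bar> ^ (2 * 0 + 1)) =
      \<bar>x - m\<bar> * exp (- (b * (x - m)\<^sup>2))" for x
  proof -
    have "sqrt (2 * pi * s\<^sup>2) > 0" using s(1) by simp
    moreover have "(x - m)\<^sup>2 / (2 * s\<^sup>2) = b * (x - m)\<^sup>2"
      unfolding s(2) using assms by simp
    ultimately show ?thesis
      unfolding normal_density_def using s(1) by simp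
  qed
  show ?thesis using moment unfolding val integrand .
qed

lemma integrable_unif01_bounded:
  fixes f :: "real \<Rightarrow> real"
  assumes "f \<in> borel_measurable unif01" and "\<And>v. v \<in> {0<..<1} \<Longrightarrow> \<bar>f v\<bar> \<le> B"
  shows "integrable unif01 f"
proof -
  interpret prob_space unif01 by (rule prob_space_unif01)
  show ?thesis
    by (rule integrable_const_bound[of _ B]) (use assms in auto)
qed

lemma measurable_unif01_id [measurable]: "(\<lambda>v. v) \<in> borel_measurable unif01"
  unfolding unif01_def by (rule measurable_restrict_space1) simp

text \<open>The numerator of the centred mean is at most the first absolute moment of a Gaussian
  envelope, hence \<open>O(1 / b)\<close>, whereas the denominator is bounded below on a short interval.\<close>

lemma mean_deviation_bound:
  fixes w :: "real \<Rightarrow> real"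
  assumes [measurable]: "w \<in> borel_measurable unif01"
    and nonneg: "\<And>v. v \<in> {0<..<1} \<Longrightarrow> 0 \<le> w v"
    and upper: "\<And>v. v \<in> {0<..<1} \<Longrightarrow> w v \<le> A * exp (- (b * (v - v0)\<^sup>2))"
    and lower: "\<And>v. v \<in> {v0<..<v0 + r} \<Longrightarrow> a \<le> w v"
    and pos: "b > 0" "a > 0" "r > 0" and v0: "0 < v0" "v0 + r \<le> 1"
  shows "\<bar>(\<integral>v. v * w v \<partial>unif01) / (\<integral>v. w v \<partial>unif01) - v0\<bar> \<le> A / (a * b * r)"
proof -
  \<comment> \<open>The envelope takes the value \<open>A\<close> at \<open>v0\<close>, where the
    weight is nonnegative.\<close>
  have "0 \<le> A"
  proof -
    have "0 \<le> A * exp (- (b * (v0 - v0)\<^sup>2))"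
      using nonneg[of v0] upper[of v0] v0 pos by simp
    then show ?thesis by simp
  qed
  have wA: "w v \<le> A" if "v \<in> {0<..<1}" for v
  proof -
    have "A * exp (- (b * (v - v0)\<^sup>2)) \<le> A * 1"
      using pos \<open>0 \<le> A\<close> by (intro mult_left_mono) auto
    with upper[OF that] show ?thesis by simp
  qed
  have int_w: "integrable unif01 w"
    by (rule integrable_unif01_bounded[of _ A]) (use nonneg wA in auto)
  have int_vw: "integrable unif01 (\<lambda>v. v * w v)"
  proof (rule integrable_unif01_bounded[of _ A])
    fix v :: real assume v: "v \<in> {0<..<1}"
    have "v * w v \<le> 1 * A"
      using v nonneg[OF v] wA[OF v] by (intro mult_mono) auto
    then show "\<bar>v * w v\<bar> \<le> A" using v nonneg[OF v] by (simp add: abs_mult)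
  qed measurable
  have int_abs: "integrable unif01 (\<lambda>v. \<bar>v - v0\<bar> * w v)"
  proof (rule integrable_unif01_bounded[of _ A])
    fix v :: real assume v: "v \<in> {0<..<1}"
    have "\<bar>v - v0\<bar> * w v \<le> 1 * A"
      using v v0 pos nonneg[OF v] wA[OF v] by (intro mult_mono) auto
    then show "\<bar>\<bar>v - v0\<bar> * w v\<bar> \<le> A" using nonneg[OF v] by (simp add: abs_mult)
  qed measurable
  let ?W = "\<integral>v. w v \<partial>unif01"
  \<comment> \<open>The total mass is at least that of the short interval, which stays inside the
    unit interval because \<open>v0 + r \<le> 1\<close>.\<close>
  have "a * r = (\<integral>v. a * indicator {v0<..<v0 + r} v \<partial>unif01)"
    using v0 pos by (simp add: unif01_def measure_restrict_space subset_iff)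
  also have "\<dots> \<le> ?W"
  proof (rule integral_mono)
    show "integrable unif01 (\<lambda>v. a * indicator {v0<..<v0 + r} v)"
      using v0 pos
      by (intro integrable_mult_right integrable_real_indicator)
         (auto simp: unif01_def sets_restrict_space_iff emeasure_restrict_space subset_iff)
    show "a * indicator {v0<..<v0 + r} v \<le> w v" if "v \<in> space unif01" for v
      using that nonneg[of v] lower[of v] by (auto simp: indicator_def)
  qed fact
  finally have W: "a * r \<le> ?W" .
  have "0 < a * r" using pos by simp
  with W have Wpos: "0 < ?W" by linarith
  note gauss = lborel_integral_abs_gaussian[OF \<open>b > 0\<close>, of v0]
  let ?h = "\<lambda>v. A * (\<bar>v - v0\<bar> * exp (- (b * (v - v0)\<^sup>2)))"
  have h: "has_bochner_integral lborel ?h (A * (1 / b))"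
    by (intro has_bochner_integral_mult_right gauss)
  have int_h: "integrable lborel ?h" using h by (simp add: has_bochner_integral_iff)
  have set_h: "set_integrable lborel {0<..<1} ?h"
    using int_h unfolding set_integrable_def by (intro integrable_mult_indicator) auto
  have "(\<integral>v. \<bar>v - v0\<bar> * w v \<partial>unif01) \<le> (\<integral>v. ?h v \<partial>unif01)"
  proof (rule integral_mono[OF int_abs])
    show "integrable unif01 ?h"
      using set_h unfolding unif01_def set_integrable_def by (subst integrable_restrict_space) auto
    show "\<bar>v - v0\<bar> * w v \<le> ?h v" if "v \<in> space unif01" for v
      using upper[of v] that mult_left_mono[of "w v" "A * exp (- (b * (v - v0)\<^sup>2))" "\<bar>v - v0\<bar>"]
      by (simp add: mult_ac)
  qed
  \<comment> \<open>The envelope is nonnegative, so its integral can only grow when extended to the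
    real line, where the Gaussian moment is known.\<close>
  also have "\<dots> = (\<integral>v. indicator {0<..<1} v *\<^sub>R ?h v \<partial>lborel)"
    unfolding unif01_def by (rule integral_restrict_space) simp
  also have "\<dots> \<le> (\<integral>v. ?h v \<partial>lborel)"
  proof (rule integral_mono[OF set_h[unfolded set_integrable_def] int_h])
    show "indicator {0<..<1} v *\<^sub>R ?h v \<le> ?h v" for v
      using \<open>0 \<le> A\<close> by (simp add: indicator_def)
  qed
  also have "\<dots> = A / b" using h by (simp add: has_bochner_integral_iff)
  finally have N: "(\<integral>v. \<bar>v - v0\<bar> * w v \<partial>unif01) \<le> A / b" .
  \<comment> \<open>Numerator minus \<open>v0\<close> times denominator is the integral of the
    centred weight; dividing by the mass gives the deviation of the mean.\<close>
  have "\<bar>(\<integral>v. v * w v \<partial>unif01) - v0 * ?W\<bar> = \<bar>\<integral>v. (v - v0) * w v \<partial>unif01\<bar>"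
    using int_w int_vw by (simp add: left_diff_distrib)
  also have "\<dots> \<le> (\<integral>v. \<bar>(v - v0) * w v\<bar> \<partial>unif01)"
    by (rule integral_abs_bound)
  also have "\<dots> = (\<integral>v. \<bar>v - v0\<bar> * w v \<partial>unif01)"
    using nonneg by (intro Bochner_Integration.integral_cong) (auto simp: abs_mult)
  finally have "\<bar>(\<integral>v. v * w v \<partial>unif01) - v0 * ?W\<bar> \<le> A / b" using N by linarith
  moreover have "\<bar>(\<integral>v. v * w v \<partial>unif01) / ?W - v0\<bar> = \<bar>(\<integral>v. v * w v \<partial>unif01) - v0 * ?W\<bar> / ?W"
    using Wpos by (simp add: field_simps abs_div_pos[symmetric])
  ultimately have "\<bar>(\<integral>v. v * w v \<partial>unif01) / ?W - v0\<bar> \<le> (A / b) / ?W"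
    using Wpos by (simp only: divide_right_mono less_imp_le)
  also have "\<dots> \<le> (A / b) / (a * r)"
    using W Wpos \<open>0 \<le> A\<close> \<open>0 < a * r\<close> pos
    by (intro divide_left_mono mult_pos_pos divide_nonneg_pos)
  finally show ?thesis by (simp add: mult_ac)
qed

section \<open>From finitely many points to the whole unit interval\<close>

text \<open>Compactness asks for the closed interval, while the net must lie in the open one, the
  parameter space. Hence the closed interval is covered by balls with interior centres.\<close>

lemma unit_interval_finite_net:
  fixes e :: real
  assumes "e > 0"
  obtains Q where "finite Q" "Q \<subseteq> {0<..<1}" "\<And>v. v \<in> {0<..<1} \<Longrightarrow> \<exists>q\<in>Q. \<bar>v - q\<bar> < e"
proof -
  have "{0..1::real} \<subseteq> (\<Union>q\<in>{0<..<1}. ball q e)"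
  proof
    fix x :: real assume x: "x \<in> {0..1}"
    define s where "s = min 1 e / 2"
    have s: "0 < s" "s < 1" "s < e" using assms by (auto simp: s_def min_def)
    \<comment> \<open>Moving \<open>x\<close> towards the midpoint by the fraction \<open>s\<close>
      reaches the open interval even from an end point, and moves by less than
      \<open>e\<close>.\<close>
    define q where "q = (1 - s) * x + s * (1 / 2)"
    have "0 \<le> (1 - s) * x" "(1 - s) * x \<le> 1 - s"
      using s x by (auto simp: mult_left_le)
    then have q: "q \<in> {0<..<1}" using s unfolding q_def greaterThanLessThan_iff by linarith
    have "q - x = s * (1 / 2 - x)" by (simp add: q_def algebra_simps)
    then have "\<bar>q - x\<bar> = s * \<bar>1 / 2 - x\<bar>" using s by (simp add: abs_mult)
    moreover have "s * \<bar>1 / 2 - x\<bar> \<le> s * 1"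
      using s x by (intro mult_left_mono) (auto simp: abs_le_iff)
    ultimately have "\<bar>q - x\<bar> < e" using s by linarith
    with q show "x \<in> (\<Union>q\<in>{0<..<1}. ball q e)" by (auto simp: dist_real_def)
  qed
  then obtain Q :: "real set" where "Q \<subseteq> {0<..<1}" "finite Q" "{0..1} \<subseteq> (\<Union>q\<in>Q. ball q e)"
    by (rule compactE_image[OF compact_Icc open_ball])
  note Q = this
  show ?thesis
  proof (rule that[OF Q(2,1)])
    fix v :: real assume "v \<in> {0<..<1}"
    then have "v \<in> {0..1}" by simp
    then have "v \<in> (\<Union>q\<in>Q. ball q e)" using Q(3) by (rule subsetD[rotated])
    then show "\<exists>q\<in>Q. \<bar>v - q\<bar> < e"
      by (auto simp: dist_real_def abs_minus_commute)
  qed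
qed

text \<open>Pointwise closeness of \<open>F\<close> to \<open>l\<close> at one point near \<open>v0\<close> pins down the second Taylor
  coefficient \<open>b\<close>; since the third-order remainder is controlled, this makes \<open>F\<close> Lipschitz, and
  closeness on a finite net then transfers the separation of the minimum of \<open>l\<close> to \<open>F\<close>.\<close>

lemma uniform_quadratic_growth:
  fixes l :: "real \<Rightarrow> real" and M K :: real
  assumes min: "global_min_at l v0" and convex: "strictly_locally_convex_at l v0"
    and M: "M \<ge> 0" and K: "K > 0"
  obtains Q \<delta> m C \<beta> D0 where
    "finite Q" "Q \<subseteq> {0<..<1}" "\<delta> > 0" "m > 0" "D0 \<ge> 1"
    "\<And>F F' a b D. D \<ge> D0 \<Longrightarrow>
       (\<And>v. v \<in> {0<..<1} \<Longrightarrow> (F has_real_derivative F' v) (at v)) \<Longrightarrow>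
       (\<And>v. v \<in> {0<..<1} \<Longrightarrow> \<bar>F v - a * (v - v0) - b / 2 * (v - v0)\<^sup>2\<bar> \<le> K / 6 * \<bar>v - v0\<bar> ^ 3) \<Longrightarrow>
       (\<And>v. v \<in> {0<..<1} \<Longrightarrow> \<bar>F' v - a - b * (v - v0)\<bar> \<le> K / 2 * (v - v0)\<^sup>2) \<Longrightarrow>
       \<bar>a\<bar> \<le> M / sqrt D \<Longrightarrow>
       (\<And>q. q \<in> Q \<Longrightarrow> \<bar>F q - (l q - l v0)\<bar> \<le> \<delta>) \<Longrightarrow>
       b \<le> \<beta> \<and> (\<forall>v\<in>{0<..<1}. m * (v - v0)\<^sup>2 - C / D \<le> F v)"
proof -
  have v0: "v0 \<in> {0<..<1}" using min by (simp add: global_min_at_def)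
  have l_min: "l v0 \<le> l v" if "v \<in> {0<..<1}" for v
  proof (cases "v = v0")
    case False
    then have "\<bar>v - v0\<bar> > 0" by simp
    with min that obtain \<eta> where "\<eta> > 0" "l v \<ge> l v0 + \<eta>"
      unfolding global_min_at_def by (meson order_refl)
    then show ?thesis by simp
  qed simp
  obtain \<kappa> where \<kappa>: "\<kappa> > 0"
    "\<And>\<rho>. \<rho> > 0 \<Longrightarrow> \<exists>t>0. t < \<rho> \<and> v0 + t < 1 \<and> l (v0 + t) - l v0 \<ge> \<kappa> * t\<^sup>2"
    using convex_min_growth[OF convex v0 l_min] by blast
  \<comment> \<open>Within distance \<open>\<rho>\<close> the cubic remainder is at most
    \<open>\<kappa> / 8\<close> times the squared distance.\<close>
  define \<rho> where "\<rho> = 3 * \<kappa> / (4 * K)"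
  have \<rho>: "\<rho> > 0" "K * \<rho> = 3 / 4 * \<kappa>" using \<kappa> K by (simp_all add: \<rho>_def)
  obtain \<tau> where \<tau>: "\<tau> > 0" "\<tau> < \<rho>" "v0 + \<tau> < 1" "l (v0 + \<tau>) - l v0 \<ge> \<kappa> * \<tau>\<^sup>2"
    using \<kappa>(2)[OF \<rho>(1)] by blast
  obtain \<eta> where \<eta>: "\<eta> > 0" "\<And>x. x \<in> {0<..<1} \<Longrightarrow> \<bar>x - v0\<bar> \<ge> \<rho> / 2 \<Longrightarrow> l x \<ge> l v0 + \<eta>"
    using min \<rho>(1) unfolding global_min_at_def by (meson half_gt_zero)
  \<comment> \<open>The first bound lets the value at \<open>v0 + \<tau>\<close> determine
    \<open>b\<close>; the second keeps \<open>F\<close> large at net points far from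
    \<open>v0\<close>.\<close>
  define \<delta> where "\<delta> = min (\<kappa> * \<tau>\<^sup>2 / 8) (\<eta> / 4)"
  have \<delta>: "\<delta> > 0" "\<delta> \<le> \<kappa> * \<tau>\<^sup>2 / 8" "\<delta> \<le> \<eta> / 4" using \<kappa> \<tau> \<eta> by (simp_all add: \<delta>_def)
  \<comment> \<open>Upper bound for \<open>b\<close>: the quadratic term at \<open>\<tau>\<close>
    matches the increment of \<open>l\<close> up to errors of
    \<open>\<kappa> * \<tau>\<^sup>2 / 2\<close>.\<close>
  define \<beta> where "\<beta> = 2 * (l (v0 + \<tau>) - l v0) / \<tau>\<^sup>2 + \<kappa>"
  have "l (v0 + \<tau>) \<ge> l v0" using l_min[of "v0 + \<tau>"] \<tau> v0 by simp
  then have \<beta>: "\<beta> > 0" using \<kappa> by (simp add: \<beta>_def add_nonneg_pos)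
  \<comment> \<open>\<open>\<Lambda>\<close> will bound the derivative of \<open>F\<close>, with one
    summand for each term of its expansion.\<close>
  define \<Lambda> where "\<Lambda> = M + \<beta> + K"
  have \<Lambda>: "\<Lambda> > 0" using M \<beta> K by (simp add: \<Lambda>_def)
  \<comment> \<open>The mesh keeps the net point near a far \<open>v\<close> at distance at least
    \<open>\<rho> / 2\<close> from \<open>v0\<close>, and moving to it changes \<open>F\<close> by
    at most \<open>\<eta> / 4\<close>.\<close>
  define e where "e = min (\<rho> / 2) (\<eta> / (4 * \<Lambda>))"
  have "\<Lambda> * e \<le> \<Lambda> * (\<eta> / (4 * \<Lambda>))"
    using \<Lambda> by (intro mult_left_mono) (simp_all add: e_def)
  then have e: "e > 0" "e \<le> \<rho> / 2" "\<Lambda> * e \<le> \<eta> / 4"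
    using \<Lambda> \<eta> \<rho> by (simp_all add: e_def)
  obtain N where N: "finite N" "N \<subseteq> {0<..<1}" "\<And>v. v \<in> {0<..<1} \<Longrightarrow> \<exists>q\<in>N. \<bar>v - q\<bar> < e"
    using unit_interval_finite_net[OF e(1)] by blast
  \<comment> \<open>From \<open>D0\<close> on the linear coefficient is at most
    \<open>\<kappa> * \<tau> / 4\<close> in absolute value.\<close>
  define D0 where "D0 = max 1 ((4 * M / (\<kappa> * \<tau>))\<^sup>2)"
  define m where "m = min (\<kappa> / 4) (\<eta> / 2)"
  show ?thesis
  proof
    show "finite (insert (v0 + \<tau>) N)" "insert (v0 + \<tau>) N \<subseteq> {0<..<1}"
      using N \<tau> v0 by auto
    show "\<delta> > 0" by fact
    show "m > 0" using \<kappa> \<eta> by (simp add: m_def)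
    show "D0 \<ge> 1" by (simp add: D0_def)
    fix F F' :: "real \<Rightarrow> real" and a b D :: real
    assume D: "D \<ge> D0"
      and deriv: "\<And>v. v \<in> {0<..<1} \<Longrightarrow> (F has_real_derivative F' v) (at v)"
      and F: "\<And>v. v \<in> {0<..<1} \<Longrightarrow> \<bar>F v - a * (v - v0) - b / 2 * (v - v0)\<^sup>2\<bar> \<le> K / 6 * \<bar>v - v0\<bar> ^ 3"
      and F': "\<And>v. v \<in> {0<..<1} \<Longrightarrow> \<bar>F' v - a - b * (v - v0)\<bar> \<le> K / 2 * (v - v0)\<^sup>2"
      and a: "\<bar>a\<bar> \<le> M / sqrt D"
      and close: "\<And>q. q \<in> insert (v0 + \<tau>) N \<Longrightarrow> \<bar>F q - (l q - l v0)\<bar> \<le> \<delta>"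
    have D1: "D \<ge> 1" "sqrt D \<ge> 1" using D by (simp_all add: D0_def)
    have "4 * M / (\<kappa> * \<tau>) \<le> sqrt D"
      using D by (intro real_le_rsqrt) (simp add: D0_def)
    then have "M / sqrt D \<le> \<kappa> * \<tau> / 4"
      using \<kappa> \<tau> D1 by (simp add: field_simps)
    with a have a1: "\<bar>a\<bar> \<le> \<kappa> * \<tau> / 4" by linarith
    have "M / sqrt D \<le> M" using M D1 by (simp add: field_simps mult_left_le mult_le_cancel_left1)
    with a have a2: "\<bar>a\<bar> \<le> M" by linarith
    have "a\<^sup>2 \<le> (M / sqrt D)\<^sup>2" using a by (metis abs_ge_zero power2_abs power_mono)
    then have a3: "a\<^sup>2 \<le> M\<^sup>2 / D" using D1 by (simp add: power_divide)
    have a\<tau>: "\<bar>a * \<tau>\<bar> \<le> \<kappa> * \<tau>\<^sup>2 / 4"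
      using mult_right_mono[OF a1, of \<tau>] \<tau> by (simp add: abs_mult power2_eq_square)
    have remainder: "K / 6 * \<bar>t\<bar> ^ 3 \<le> \<kappa> / 8 * t\<^sup>2" if "\<bar>t\<bar> \<le> \<rho>" for t
    proof -
      have "K * \<bar>t\<bar> \<le> 3 / 4 * \<kappa>"
        using mult_left_mono[OF that, of K] K \<rho>(2) by simp
      then have "K * \<bar>t\<bar> * t\<^sup>2 \<le> 3 / 4 * \<kappa> * t\<^sup>2" by (rule mult_right_mono) simp
      moreover have "\<bar>t\<bar> ^ 3 = \<bar>t\<bar> * t\<^sup>2" by (simp add: power3_eq_cube power2_eq_square)
      ultimately show ?thesis by simp
    qed
    have F\<tau>: "\<bar>F (v0 + \<tau>) - a * \<tau> - b / 2 * \<tau>\<^sup>2\<bar> \<le> \<kappa> / 8 * \<tau>\<^sup>2"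
      using F[of "v0 + \<tau>"] remainder[of \<tau>] \<tau> v0 by simp
    have l\<tau>: "\<bar>F (v0 + \<tau>) - (l (v0 + \<tau>) - l v0)\<bar> \<le> \<kappa> * \<tau>\<^sup>2 / 8"
      using close[of "v0 + \<tau>"] \<delta>(2) by simp
    \<comment> \<open>Of the growth \<open>\<kappa> * \<tau>\<^sup>2\<close> of \<open>l\<close>,
      the linear term takes at most a quarter, remainder and closeness an eighth each; the remaining
      half must come from the quadratic term.\<close>
    have "b / 2 * \<tau>\<^sup>2 \<ge> \<kappa> * \<tau>\<^sup>2 / 2"
      using F\<tau> l\<tau> a\<tau> \<tau>(4) by linarith
    then have "\<kappa> * \<tau>\<^sup>2 \<le> b * \<tau>\<^sup>2" by simp
    then have b1: "b \<ge> \<kappa>" using \<tau>(1) by (simp add: mult_le_cancel_right)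
    have "b / 2 * \<tau>\<^sup>2 \<le> (l (v0 + \<tau>) - l v0) + \<kappa> * \<tau>\<^sup>2 / 2"
      using F\<tau> l\<tau> a\<tau> by linarith
    then have "b * \<tau>\<^sup>2 \<le> \<beta> * \<tau>\<^sup>2" using \<tau>(1) by (simp add: \<beta>_def distrib_right)
    then have b2: "b \<le> \<beta>" using \<tau>(1) by (simp add: mult_le_cancel_right)
    have lipschitz: "\<bar>F' v\<bar> \<le> \<Lambda>" if "v \<in> {0<..<1}" for v
    proof -
      have t: "\<bar>v - v0\<bar> \<le> 1" using that v0 by auto
      have "\<bar>b * (v - v0)\<bar> \<le> b * 1"
        unfolding abs_mult using t b1 \<kappa> by (intro mult_mono) auto
      moreover have "K / 2 * (v - v0)\<^sup>2 \<le> K / 2 * 1"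
        using t K by (intro mult_left_mono) (simp_all add: abs_square_le_1)
      ultimately show ?thesis using F'[OF that] a2 b2 K unfolding \<Lambda>_def by linarith
    qed
    have "m * (v - v0)\<^sup>2 - 2 * M\<^sup>2 / \<kappa> / D \<le> F v" if v: "v \<in> {0<..<1}" for v
    proof (cases "\<bar>v - v0\<bar> \<le> \<rho>")
      case True
      define t where "t = v - v0"
      \<comment> \<open>Completing the square splits the linear term into a part absorbed by the
        quadratic growth and \<open>2 * a\<^sup>2 / \<kappa>\<close>, which is of order
        \<open>1 / D\<close> and yields the constant
        \<open>2 * M\<^sup>2 / \<kappa>\<close>.\<close>
      have "0 \<le> (\<kappa> * \<bar>t\<bar> / 2 - 2 * \<bar>a\<bar>)\<^sup>2 / (2 * \<kappa>)" using \<kappa> by simp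
      also have "\<dots> = \<kappa> / 8 * t\<^sup>2 + 2 * a\<^sup>2 / \<kappa> - \<bar>a * t\<bar>"
        using \<kappa>(1) by (simp add: power2_eq_square abs_mult field_simps)
      finally have "\<bar>a * t\<bar> \<le> \<kappa> / 8 * t\<^sup>2 + 2 * a\<^sup>2 / \<kappa>" by simp
      moreover have "2 * a\<^sup>2 / \<kappa> \<le> 2 * (M\<^sup>2 / D) / \<kappa>"
        using a3 \<kappa> by (intro divide_right_mono mult_left_mono) auto
      moreover have "\<kappa> / 2 * t\<^sup>2 \<le> b / 2 * t\<^sup>2" using b1 by (intro mult_right_mono) auto
      moreover have "\<bar>F v - a * t - b / 2 * t\<^sup>2\<bar> \<le> \<kappa> / 8 * t\<^sup>2"
        using F[OF v] remainder[of t] True by (simp add: t_def)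
      moreover have "m * t\<^sup>2 \<le> \<kappa> / 4 * t\<^sup>2" by (intro mult_right_mono) (simp_all add: m_def)
      moreover have "2 * M\<^sup>2 / \<kappa> / D = 2 * (M\<^sup>2 / D) / \<kappa>" by simp
      ultimately show ?thesis unfolding t_def[symmetric] by linarith
    next
      case False
      \<comment> \<open>Far from \<open>v0\<close> the net point has
        \<open>F q \<ge> 3 / 4 * \<eta>\<close>, and passing to \<open>v\<close> costs at most
        \<open>\<eta> / 4\<close>. The \<open>\<eta> / 2\<close> left over dominates the parabola
        since \<open>\<bar>v - v0\<bar> \<le> 1\<close>.\<close>
      obtain q where q: "q \<in> N" "\<bar>v - q\<bar> < e" using N(3)[OF v] by blast
      have q01: "q \<in> {0<..<1}" using q N by auto
      have "\<bar>q - v0\<bar> \<ge> \<rho> / 2" using False q e(2) by linarith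
      then have "l q \<ge> l v0 + \<eta>" using \<eta>(2) q01 by blast
      then have "F q \<ge> \<eta> - \<eta> / 4" using close[of q] q \<delta>(3) by (simp add: abs_le_iff)
      moreover have "norm (F v - F q) \<le> \<Lambda> * norm (v - q)"
      proof (rule field_differentiable_bound)
        show "convex {0<..<1::real}" by (rule convex_real_interval)
        show "(F has_field_derivative F' z) (at z within {0<..<1})" if "z \<in> {0<..<1}" for z
          by (rule has_field_derivative_at_within[OF deriv[OF that]])
        show "norm (F' z) \<le> \<Lambda>" if "z \<in> {0<..<1}" for z
          using lipschitz[OF that] by simp
      qed (rule v q01)+
      moreover have "\<Lambda> * \<bar>v - q\<bar> \<le> \<Lambda> * e"
        using \<Lambda> q by (intro mult_left_mono) auto
      ultimately have "F v \<ge> \<eta> / 2" using e(3) unfolding real_norm_def by linarith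
      moreover have "m * (v - v0)\<^sup>2 \<le> \<eta> / 2 * 1"
        using v v0 \<eta>(1) by (intro mult_mono) (auto simp: m_def abs_square_le_1)
      moreover have "0 \<le> 2 * M\<^sup>2 / \<kappa> / D" using \<kappa> D1 by simp
      ultimately show ?thesis by linarith
    qed
    with b2 show "b \<le> \<beta> \<and> (\<forall>v\<in>{0<..<1}. m * (v - v0)\<^sup>2 - 2 * M\<^sup>2 / \<kappa> / D \<le> F v)" by blast
  qed
qed

text \<open>Here \<open>L\<close> stands for a log-likelihood with score \<open>s1\<close> and second derivative \<open>s2\<close> at the
  true value, so that the ratio of integrals is the posterior mean under the uniform prior.\<close>

lemma posterior_mean_deviation:
  fixes l :: "real \<Rightarrow> real" and M K :: real
  assumes min: "global_min_at l v0" and convex: "strictly_locally_convex_at l v0"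
    and M: "M \<ge> 0" and K: "K > 0"
  obtains Q \<delta> B D0 where
    "finite Q" "Q \<subseteq> {0<..<1}" "\<delta> > 0"
    "\<And>L L' s1 s2 D. D \<ge> D0 \<Longrightarrow>
       (\<And>v. v \<in> {0<..<1} \<Longrightarrow> (L has_real_derivative L' v) (at v)) \<Longrightarrow>
       (\<And>v. v \<in> {0<..<1} \<Longrightarrow>
          \<bar>L v - L v0 - s1 * (v - v0) - s2 / 2 * (v - v0)\<^sup>2\<bar> \<le> K * D / 6 * \<bar>v - v0\<bar> ^ 3) \<Longrightarrow>
       (\<And>v. v \<in> {0<..<1} \<Longrightarrow> \<bar>L' v - s1 - s2 * (v - v0)\<bar> \<le> K * D / 2 * (v - v0)\<^sup>2) \<Longrightarrow>
       \<bar>s1\<bar> \<le> M * sqrt D \<Longrightarrow>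
       (\<And>q. q \<in> Q \<Longrightarrow> \<bar>- L q / D - l q\<bar> \<le> \<delta>) \<Longrightarrow>
       \<bar>(\<integral>v. v * exp (L v) \<partial>unif01) / (\<integral>v. exp (L v) \<partial>unif01) - v0\<bar> \<le> B / sqrt D"
proof -
  have v0: "v0 \<in> {0<..<1}" using min by (simp add: global_min_at_def)
  obtain Q \<delta> m C \<beta> D0 where Q: "finite Q" "Q \<subseteq> {0<..<1}" and \<delta>: "\<delta> > 0" and m: "m > 0"
    and D0: "D0 \<ge> 1" and growth:
    "\<And>F F' a b D. D \<ge> D0 \<Longrightarrow>
       (\<And>v. v \<in> {0<..<1} \<Longrightarrow> (F has_real_derivative F' v) (at v)) \<Longrightarrow>
       (\<And>v. v \<in> {0<..<1} \<Longrightarrow> \<bar>F v - a * (v - v0) - b / 2 * (v - v0)\<^sup>2\<bar> \<le> K / 6 * \<bar>v - v0\<bar> ^ 3) \<Longrightarrow>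
       (\<And>v. v \<in> {0<..<1} \<Longrightarrow> \<bar>F' v - a - b * (v - v0)\<bar> \<le> K / 2 * (v - v0)\<^sup>2) \<Longrightarrow>
       \<bar>a\<bar> \<le> M / sqrt D \<Longrightarrow>
       (\<And>q. q \<in> Q \<Longrightarrow> \<bar>F q - (l q - l v0)\<bar> \<le> \<delta>) \<Longrightarrow>
       b \<le> \<beta> \<and> (\<forall>v\<in>{0<..<1}. m * (v - v0)\<^sup>2 - C / D \<le> F v)"
    using uniform_quadratic_growth[OF assms] by metis
  \<comment> \<open>On the short window right of \<open>v0\<close> used below, the linear, quadratic
    and remainder terms lower \<open>L v - L v0\<close> by at most \<open>M\<close>,
    \<open>\<bar>\<beta>\<bar>\<close> and \<open>K\<close>.\<close>
  define E where "E = M + \<bar>\<beta>\<bar> + K"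
  define B where "B = exp C / (exp (- E) * m * (1 - v0))"
  show ?thesis
  proof
    \<comment> \<open>\<open>v0\<close> joins the net because \<open>F\<close> is centred at
      \<open>L v0\<close>; the two resulting errors get half of \<open>\<delta>\<close>
      each.\<close>
    show "finite (insert v0 Q)" "insert v0 Q \<subseteq> {0<..<1}" using Q v0 by auto
    show "\<delta> / 2 > 0" using \<delta> by simp
    fix L L' :: "real \<Rightarrow> real" and s1 s2 D :: real
    assume D: "D \<ge> D0"
      and deriv: "\<And>v. v \<in> {0<..<1} \<Longrightarrow> (L has_real_derivative L' v) (at v)"
      and L: "\<And>v. v \<in> {0<..<1} \<Longrightarrow>
          \<bar>L v - L v0 - s1 * (v - v0) - s2 / 2 * (v - v0)\<^sup>2\<bar> \<le> K * D / 6 * \<bar>v - v0\<bar> ^ 3"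
      and L': "\<And>v. v \<in> {0<..<1} \<Longrightarrow> \<bar>L' v - s1 - s2 * (v - v0)\<bar> \<le> K * D / 2 * (v - v0)\<^sup>2"
      and s1: "\<bar>s1\<bar> \<le> M * sqrt D"
      and close: "\<And>q. q \<in> insert v0 Q \<Longrightarrow> \<bar>- L q / D - l q\<bar> \<le> \<delta> / 2"
    have Dpos: "D > 0" "D \<ge> 1" "sqrt D \<ge> 1" using D D0 by auto
    have sqrtD: "sqrt D * sqrt D = D" using Dpos by simp
    have scale: "\<bar>- x / D\<bar> \<le> y" if "\<bar>x\<bar> \<le> y * D" for x y
      using that Dpos(1) by (simp add: abs_divide pos_divide_le_eq)
    define F where "F v = - (L v - L v0) / D" for v
    have F_eq: "L v - L v0 = - D * F v" for v using Dpos by (simp add: F_def)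
    have "- s2 / D \<le> \<beta> \<and> (\<forall>v\<in>{0<..<1}. m * (v - v0)\<^sup>2 - C / D \<le> F v)"
    proof (rule growth[OF D, of F "\<lambda>v. - L' v / D" "- s1 / D"])
      fix v :: real assume v: "v \<in> {0<..<1}"
      show "(F has_real_derivative - L' v / D) (at v)"
        unfolding F_def using Dpos by (auto intro!: derivative_eq_intros deriv[OF v])
      have "F v - - s1 / D * (v - v0) - - s2 / D / 2 * (v - v0)\<^sup>2 =
            - (L v - L v0 - s1 * (v - v0) - s2 / 2 * (v - v0)\<^sup>2) / D"
        using Dpos by (simp add: F_def field_simps)
      moreover have "\<bar>- (L v - L v0 - s1 * (v - v0) - s2 / 2 * (v - v0)\<^sup>2) / D\<bar> \<le> K / 6 * \<bar>v - v0\<bar> ^ 3"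
        using L[OF v] by (intro scale) (simp only: mult_ac times_divide_eq_left times_divide_eq_right)
      ultimately show "\<bar>F v - - s1 / D * (v - v0) - - s2 / D / 2 * (v - v0)\<^sup>2\<bar> \<le> K / 6 * \<bar>v - v0\<bar> ^ 3"
        by (simp only:)
      have "- L' v / D - - s1 / D - - s2 / D * (v - v0) = - (L' v - s1 - s2 * (v - v0)) / D"
        using Dpos by (simp add: field_simps)
      moreover have "\<bar>- (L' v - s1 - s2 * (v - v0)) / D\<bar> \<le> K / 2 * (v - v0)\<^sup>2"
        using L'[OF v] by (intro scale) (simp only: mult_ac times_divide_eq_left times_divide_eq_right)
      ultimately show "\<bar>- L' v / D - - s1 / D - - s2 / D * (v - v0)\<bar> \<le> K / 2 * (v - v0)\<^sup>2"
        by (simp only:)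
    next
      have "\<bar>s1\<bar> / D \<le> M * sqrt D / D" using s1 Dpos by (intro divide_right_mono) auto
      also have "\<dots> = M / sqrt D" using Dpos sqrtD by (simp add: field_simps)
      finally show "\<bar>- s1 / D\<bar> \<le> M / sqrt D" using Dpos by simp
    next
      fix q assume "q \<in> Q"
      then have "\<bar>- L q / D - l q\<bar> \<le> \<delta> / 2" "\<bar>- L v0 / D - l v0\<bar> \<le> \<delta> / 2"
        using close by auto
      moreover have "F q = - L q / D - - L v0 / D" by (simp add: F_def diff_divide_distrib)
      ultimately show "\<bar>F q - (l q - l v0)\<bar> \<le> \<delta>" by linarith
    qed
    then have s2: "- s2 / D \<le> \<beta>" and F: "\<And>v. v \<in> {0<..<1} \<Longrightarrow> m * (v - v0)\<^sup>2 - C / D \<le> F v"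
      by blast+
    let ?w = "\<lambda>v. exp (L v - L v0)"
    have "continuous_on {0<..<1} L"
      by (meson continuous_at_imp_continuous_on DERIV_isCont deriv)
    then have L_meas: "L \<in> borel_measurable unif01"
      unfolding unif01_def measurable_cong_sets[OF sets_restrict_space_cong[OF sets_lborel] refl]
      by (rule borel_measurable_continuous_on_restrict)
    \<comment> \<open>\<open>1 / sqrt D\<close> is the scale on which \<open>L\<close> drops by at
      most a constant; the factor \<open>1 - v0\<close> keeps the window in the unit
      interval.\<close>
    define r where "r = (1 - v0) / sqrt D"
    have "(1 - v0) / sqrt D \<le> (1 - v0) / 1"
      using v0 Dpos by (intro divide_left_mono) auto
    then have r: "r > 0" "r \<le> 1 - v0" using v0 Dpos by (simp_all add: r_def)
    have "\<bar>(\<integral>v. v * ?w v \<partial>unif01) / (\<integral>v. ?w v \<partial>unif01) - v0\<bar> \<le> exp C / (exp (- E) * (m * D) * r)"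
    proof (rule mean_deviation_bound)
      fix v :: real assume v: "v \<in> {0<..<1}"
      have "D * (m * (v - v0)\<^sup>2 - C / D) \<le> D * F v"
        using F[OF v] Dpos by (intro mult_left_mono) auto
      then have "L v - L v0 \<le> C + - (m * D * (v - v0)\<^sup>2)"
        unfolding F_eq using Dpos by (simp add: right_diff_distrib mult_ac)
      then show "?w v \<le> exp C * exp (- (m * D * (v - v0)\<^sup>2))"
        by (simp add: exp_add[symmetric])
    next
      fix v assume v: "v \<in> {v0<..<v0 + r}"
      define t where "t = v - v0"
      have t: "0 < t" "t < r" using v by (simp_all add: t_def)
      have v1: "v \<in> {0<..<1}" using v v0 r by auto
      have "r \<le> 1 / sqrt D" unfolding r_def using v0 Dpos by (intro divide_right_mono) auto
      with t have "t \<le> 1 / sqrt D" by simp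
      then have tD: "sqrt D * t \<le> 1" using Dpos by (simp add: field_simps)
      have t1: "t \<le> 1" using t r v0 by simp
      have "(sqrt D * t)\<^sup>2 \<le> 1" using tD t Dpos by (simp add: power_le_one)
      then have Dt2: "D * t\<^sup>2 \<le> 1" using Dpos by (simp add: power_mult_distrib)
      have "\<bar>s1 * t\<bar> \<le> M * sqrt D * t"
        using s1 t by (simp add: abs_mult mult_right_mono)
      also have "\<dots> \<le> M * 1" unfolding mult.assoc using tD M by (intro mult_left_mono)
      finally have 1: "\<bar>s1 * t\<bar> \<le> M" by simp
      have "- s2 * t\<^sup>2 \<le> \<beta> * D * t\<^sup>2"
        using s2 Dpos by (intro mult_right_mono) (simp_all add: field_simps)
      also have "\<dots> \<le> \<bar>\<beta>\<bar> * (D * t\<^sup>2)" using Dpos by (simp add: mult.assoc mult_right_mono)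
      also have "\<dots> \<le> \<bar>\<beta>\<bar> * 1" using Dt2 by (intro mult_left_mono) auto
      finally have 2: "- (s2 / 2 * t\<^sup>2) \<le> \<bar>\<beta>\<bar>" by simp
      have "K * D / 6 * \<bar>t\<bar> ^ 3 = K / 6 * (D * t\<^sup>2) * t"
        using t by (simp add: power3_eq_cube power2_eq_square)
      also have "\<dots> \<le> K / 6 * 1 * 1"
        using Dt2 t1 t K Dpos by (intro mult_mono mult_left_mono) auto
      finally have 3: "K * D / 6 * \<bar>t\<bar> ^ 3 \<le> K" using K by simp
      have "- E \<le> L v - L v0"
        using L[OF v1, folded t_def] 1 2 3 unfolding E_def by linarith
      then show "exp (- E) \<le> ?w v" by simp
    qed (use v0 r m Dpos L_meas in auto)
    also have "exp C / (exp (- E) * (m * D) * r) = B / sqrt D"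
    proof -
      have "D * r = (1 - v0) * sqrt D"
        unfolding r_def using Dpos real_div_sqrt[of D] by (simp add: field_simps)
      then have "exp (- E) * (m * D) * r = exp (- E) * m * (1 - v0) * sqrt D"
        by (simp add: mult.assoc)
      then show ?thesis by (simp add: B_def)
    qed
    \<comment> \<open>The factor \<open>exp (L v0)\<close> cancels between numerator and
      denominator.\<close>
    also have "(\<integral>v. v * ?w v \<partial>unif01) / (\<integral>v. ?w v \<partial>unif01) =
        (\<integral>v. v * exp (L v) \<partial>unif01) / (\<integral>v. exp (L v) \<partial>unif01)"
      by (simp add: exp_diff)
    finally show "\<bar>(\<integral>v. v * exp (L v) \<partial>unif01) / (\<integral>v. exp (L v) \<partial>unif01) - v0\<bar> \<le> B / sqrt D" .
  qed
qed

section \<open>Likelihood of independent observations\<close>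

lemma C3_on_derivative:
  assumes "C3_on S f" "x \<in> S" "k < 3"
  shows "((deriv ^^ k) f has_real_derivative (deriv ^^ Suc k) f x) (at x)"
  using assms by (simp add: C3_on_def DERIV_deriv_iff_real_differentiable)

text \<open>Lagrange remainders: expanding \<open>f\<close> to order three and
  \<open>deriv f\<close> to order two leaves the same third derivative, so one bound
  \<open>h\<close> serves both.\<close>

lemma C3_on_Taylor:
  fixes f :: "real \<Rightarrow> real"
  assumes C3: "C3_on {0<..<1} f" and v: "v \<in> {0<..<1}" "v0 \<in> {0<..<1}"
    and bound: "\<And>w. w \<in> {0<..<1} \<Longrightarrow> \<bar>(deriv ^^ 3) f w\<bar> \<le> h"
  shows "\<bar>f v - f v0 - deriv f v0 * (v - v0) - (deriv ^^ 2) f v0 / 2 * (v - v0)\<^sup>2\<bar> \<le> h / 6 * \<bar>v - v0\<bar> ^ 3"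
    and "\<bar>deriv f v - deriv f v0 - (deriv ^^ 2) f v0 * (v - v0)\<bar> \<le> h / 2 * (v - v0)\<^sup>2"
proof -
  have d: "((deriv ^^ k) f has_real_derivative (deriv ^^ Suc k) f x) (at x)"
    if "k < 3" "min v v0 \<le> x" "x \<le> max v v0" for k x
    using that v by (intro C3_on_derivative[OF C3]) auto
  \<comment> \<open>Index shift that makes \<open>deriv f\<close> the base function of the second
    expansion.\<close>
  have d': "((deriv ^^ Suc k) f has_real_derivative (deriv ^^ Suc (Suc k)) f x) (at x)"
    if "k < 2" "min v v0 \<le> x" "x \<le> max v v0" for k x
    using that by (intro d) auto
  have inside: "t \<in> {0<..<1}" if "if v < v0 then v < t \<and> t < v0 else v0 < t \<and> t < v" for t
    using that v by (auto split: if_splits)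
  show "\<bar>f v - f v0 - deriv f v0 * (v - v0) - (deriv ^^ 2) f v0 / 2 * (v - v0)\<^sup>2\<bar> \<le> h / 6 * \<bar>v - v0\<bar> ^ 3"
  proof (cases "v = v0")
    case False
    obtain t where t: "if v < v0 then v < t \<and> t < v0 else v0 < t \<and> t < v"
      and eq: "f v = (\<Sum>m<3. (deriv ^^ m) f v0 / fact m * (v - v0) ^ m) + (deriv ^^ 3) f t / fact 3 * (v - v0) ^ 3"
      using Taylor[of 3 "\<lambda>k. (deriv ^^ k) f" f "min v v0" "max v v0" v0 v] d False by auto
    have "f v - f v0 - deriv f v0 * (v - v0) - (deriv ^^ 2) f v0 / 2 * (v - v0)\<^sup>2 =
        (deriv ^^ 3) f t / 6 * (v - v0) ^ 3"
      unfolding eq by (simp add: numeral_3_eq_3 numeral_2_eq_2)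
    also have "\<bar>\<dots>\<bar> \<le> h / 6 * \<bar>v - v0\<bar> ^ 3"
      using bound[OF inside[OF t]] unfolding abs_mult power_abs by (intro mult_right_mono) auto
    finally show ?thesis .
  qed simp
  show "\<bar>deriv f v - deriv f v0 - (deriv ^^ 2) f v0 * (v - v0)\<bar> \<le> h / 2 * (v - v0)\<^sup>2"
  proof (cases "v = v0")
    case False
    obtain t where t: "if v < v0 then v < t \<and> t < v0 else v0 < t \<and> t < v"
      and eq: "deriv f v = (\<Sum>m<2. (deriv ^^ Suc m) f v0 / fact m * (v - v0) ^ m) + (deriv ^^ Suc 2) f t / fact 2 * (v - v0) ^ 2"
      using Taylor[of 2 "\<lambda>k. (deriv ^^ Suc k) f" "deriv f" "min v v0" "max v v0" v0 v] d' False by auto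
    have "deriv f v - deriv f v0 - (deriv ^^ 2) f v0 * (v - v0) = (deriv ^^ 3) f t / 2 * (v - v0)\<^sup>2"
      unfolding eq by (simp add: numeral_3_eq_3 numeral_2_eq_2)
    also have "\<bar>\<dots>\<bar> \<le> h / 2 * (v - v0)\<^sup>2"
      using bound[OF inside[OF t]] unfolding abs_mult by (simp add: mult_right_mono)
    finally show ?thesis .
  qed simp
qed

text \<open>Explicit increments that stay in the parameter interval turn derivatives at
  \<open>v0\<close> into limits of sequences, as needed for measurability and dominated
  convergence.\<close>

lemma filterlim_shrinking_step:
  fixes v0 :: real
  assumes "v0 \<in> {0<..<1}"
  defines "h \<equiv> \<lambda>N. (1 - v0) / real (N + 2)"
  shows "filterlim h (at 0) sequentially" "h N > 0" "v0 + h N \<in> {0<..<1}"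
proof -
  have "h \<longlonglongrightarrow> 0" unfolding h_def by real_asymp
  moreover show pos: "h N > 0" for N using assms by (simp add: h_def)
  ultimately show "filterlim h (at 0) sequentially"
    by (auto simp: filterlim_at intro!: always_eventually less_imp_neq[THEN not_sym] pos)
  have "h N \<le> (1 - v0) / 2"
    using assms(1) unfolding h_def by (intro divide_left_mono) auto
  then show "v0 + h N \<in> {0<..<1}" using pos[of N] assms(1) by auto
qed

section \<open>Independent observations from regular densities\<close>

text \<open>One group on its own, abstracted from the product space and from the other
  groups.\<close>

locale regular_sample = prob_space M for M :: "'a measure" +
  fixes X :: "nat \<Rightarrow> 'a \<Rightarrow> real" and f :: "nat \<Rightarrow> real \<Rightarrow> real \<Rightarrow> real" and v0 :: real
  assumes indep: "indep_vars (\<lambda>_. unif01) X {1..}"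
    and law: "\<And>j. j \<ge> 1 \<Longrightarrow> distr M unif01 (X j) = density unif01 (\<lambda>u. ennreal (f j u v0))"
    and copula: "\<And>j. j \<ge> 1 \<Longrightarrow> bivariate_copula_density (f j)"
    and v0: "v0 \<in> {0<..<1}"
    and regular: "mle_regular f v0"
begin

definition score :: "nat \<Rightarrow> real \<Rightarrow> real" where
  "score j u = deriv (\<lambda>w. ln (f j u w)) v0"

definition loglik :: "nat \<Rightarrow> 'a \<Rightarrow> real \<Rightarrow> real" where
  "loglik n \<omega> v = (\<Sum>j=1..n. ln (f j (X j \<omega>) v))"

definition score_sum :: "nat \<Rightarrow> 'a \<Rightarrow> real" where
  "score_sum n \<omega> = (\<Sum>j=1..n. score j (X j \<omega>))"

lemma X_measurable: "j \<ge> 1 \<Longrightarrow> X j \<in> measurable M unif01"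
  using indep by (auto simp: indep_vars_def)

lemma X_range: "j \<ge> 1 \<Longrightarrow> \<omega> \<in> space M \<Longrightarrow> X j \<omega> \<in> {0<..<1}"
  using measurable_space[OF X_measurable] by simp

lemma f_pos: "j \<ge> 1 \<Longrightarrow> u \<in> {0<..<1} \<Longrightarrow> v \<in> {0<..<1} \<Longrightarrow> 0 < f j u v"
  using regular unfolding mle_regular_def by blast

lemma C3_ln_f: "j \<ge> 1 \<Longrightarrow> u \<in> {0<..<1} \<Longrightarrow> C3_on {0<..<1} (\<lambda>v. ln (f j u v))"
  using regular unfolding mle_regular_def by blast

lemma ln_f_deriv:
  assumes "j \<ge> 1" "u \<in> {0<..<1}" "v \<in> {0<..<1}"
  shows "((\<lambda>v. ln (f j u v)) has_real_derivative deriv (\<lambda>v. ln (f j u v)) v) (at v)"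
  using C3_on_derivative[OF C3_ln_f[OF assms(1,2)] assms(3), of 0] by simp

text \<open>Smoothness is assumed for the logarithm; positivity recovers \<open>f\<close> as its
  exponential on the unit interval.\<close>

lemma f_deriv:
  assumes "j \<ge> 1" "u \<in> {0<..<1}" "v \<in> {0<..<1}"
  shows "(f j u has_real_derivative f j u v * deriv (\<lambda>v. ln (f j u v)) v) (at v)"
proof (rule has_field_derivative_transform_within_open)
  have "((\<lambda>v. exp (ln (f j u v))) has_real_derivative
      exp (ln (f j u v)) * deriv (\<lambda>v. ln (f j u v)) v) (at v)"
    by (rule DERIV_fun_exp[OF ln_f_deriv[OF assms]])
  then show "((\<lambda>v. exp (ln (f j u v))) has_real_derivative
      f j u v * deriv (\<lambda>v. ln (f j u v)) v) (at v)"
    using f_pos[OF assms] by simp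
  show "exp (ln (f j u w)) = f j u w" if "w \<in> {0<..<1}" for w
    using f_pos[OF assms(1,2) that] by simp
qed (use assms in auto)

lemma f_measurable:
  assumes "j \<ge> 1" "v \<in> {0<..<1}"
  shows "(\<lambda>u. f j u v) \<in> borel_measurable unif01"
proof -
  have "(\<lambda>u. case (u, v) of (u, v) \<Rightarrow> f j u v) \<in> borel_measurable unif01"
    using copula[OF assms(1)] assms(2) unfolding bivariate_copula_density_def
    by (intro measurable_compose[OF measurable_Pair2']) auto
  then show ?thesis by simp
qed

lemma f_integral:
  assumes "j \<ge> 1" "v \<in> {0<..<1}"
  shows "integrable unif01 (\<lambda>u. f j u v)" "(\<integral>u. f j u v \<partial>unif01) = 1"
proof -
  have nn: "(\<integral>\<^sup>+u. ennreal (f j u v) \<partial>unif01) = 1"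
    using copula[OF assms(1)] assms(2) by (simp add: bivariate_copula_density_def)
  have pos: "AE u in unif01. 0 \<le> f j u v"
    using f_pos[OF assms(1) _ assms(2)] by (intro AE_I2) (simp add: less_imp_le)
  show "integrable unif01 (\<lambda>u. f j u v)"
    using nn pos f_measurable[OF assms] by (intro integrableI_nonneg) auto
  show "(\<integral>u. f j u v \<partial>unif01) = 1"
    using nn pos f_measurable[OF assms] by (subst integral_eq_nn_integral) auto
qed

section \<open>Moments and size of the score\<close>

text \<open>The score is a pointwise limit of difference quotients in the parameter, and these are
  measurable in \<open>u\<close>.\<close>

lemma score_measurable:
  assumes "j \<ge> 1"
  shows "score j \<in> borel_measurable unif01"
proof (rule borel_measurable_LIMSEQ_real)
  define h where "h N = (1 - v0) / real (N + 2)" for N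
  note h = filterlim_shrinking_step[OF v0, folded h_def]
  show "(\<lambda>N. (ln (f j u (v0 + h N)) - ln (f j u v0)) / h N) \<longlonglongrightarrow> score j u"
    if "u \<in> space unif01" for u
    using ln_f_deriv[OF assms _ v0, of u] that h(1) unfolding score_def DERIV_def
    by (auto intro: filterlim_compose)
  show "(\<lambda>u. (ln (f j u (v0 + h N)) - ln (f j u v0)) / h N) \<in> borel_measurable unif01" for N
    using f_measurable[OF assms h(3), of N] f_measurable[OF assms v0] by measurable
qed

text \<open>Differentiation under the integral sign in \<open>(\<integral>u. f j u v \<partial>unif01) = 1\<close>, by dominated
  convergence of difference quotients.\<close>

lemma score_mean_unif01:
  assumes j: "j \<ge> 1"
  shows "integrable unif01 (\<lambda>u. f j u v0 * score j u)" "(\<integral>u. f j u v0 * score j u \<partial>unif01) = 0"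
proof -
  obtain F1 where F1: "integrable unif01 F1"
    "\<And>u v. u \<in> {0<..<1} \<Longrightarrow> v \<in> {0<..<1} \<Longrightarrow> \<bar>deriv (f j u) v\<bar> \<le> F1 u"
    using regular j unfolding mle_regular_def by meson
  define h where "h N = (1 - v0) / real (N + 2)" for N
  note h = filterlim_shrinking_step[OF v0, folded h_def]
  define q where "q N u = (f j u (v0 + h N) - f j u v0) / h N" for N u
  have q_bound: "\<bar>q N u\<bar> \<le> F1 u" if u: "u \<in> {0<..<1}" for N u
  proof -
    \<comment> \<open>The mean value inequality with the parameter-free majorant \<open>F1\<close>
      dominates all quotients at once.\<close>
    have "norm (f j u (v0 + h N) - f j u v0) \<le> F1 u * norm (v0 + h N - v0)"
    proof (rule field_differentiable_bound)
      fix z :: real assume z: "z \<in> {0<..<1}"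
      show "(f j u has_field_derivative deriv (f j u) z) (at z within {0<..<1})"
        using f_deriv[OF j u z] DERIV_imp_deriv[OF f_deriv[OF j u z]]
        by (simp add: has_field_derivative_at_within)
      show "norm (deriv (f j u) z) \<le> F1 u" using F1(2)[OF u z] by simp
    qed (use v0 h(3) in \<open>auto intro: convex_real_interval\<close>)
    then show ?thesis using h(2)[of N] by (simp add: q_def field_simps)
  qed
  have q_lim: "(\<lambda>N. q N u) \<longlonglongrightarrow> f j u v0 * score j u" if "u \<in> {0<..<1}" for u
    using f_deriv[OF j that v0] h(1) unfolding score_def DERIV_def q_def
    by (auto intro: filterlim_compose)
  have q_meas: "q N \<in> borel_measurable unif01" for N
    using f_measurable[OF j h(3), of N] f_measurable[OF j v0] unfolding q_def by measurable
  have meas: "(\<lambda>u. f j u v0 * score j u) \<in> borel_measurable unif01"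
    using f_measurable[OF j v0] score_measurable[OF j] by measurable
  have lim: "AE u in unif01. (\<lambda>N. q N u) \<longlonglongrightarrow> f j u v0 * score j u"
    and bnd: "\<And>N. AE u in unif01. norm (q N u) \<le> F1 u"
    using q_lim q_bound by (auto intro!: AE_I2)
  show "integrable unif01 (\<lambda>u. f j u v0 * score j u)"
    by (rule integrable_dominated_convergence[OF meas q_meas F1(1) lim bnd])
  have "(\<lambda>N. \<integral>u. q N u \<partial>unif01) \<longlonglongrightarrow> (\<integral>u. f j u v0 * score j u \<partial>unif01)"
    by (rule integral_dominated_convergence[OF meas q_meas F1(1) lim bnd])
  \<comment> \<open>Both densities have total mass one, so every difference quotient integrates to
    zero.\<close>
  moreover have "(\<integral>u. q N u \<partial>unif01) = 0" for N
    using f_integral[OF j h(3), of N] f_integral[OF j v0] by (simp add: q_def)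
  ultimately show "(\<integral>u. f j u v0 * score j u \<partial>unif01) = 0"
    by (simp add: LIMSEQ_const_iff)
qed

lemma f_v0_nonneg: "j \<ge> 1 \<Longrightarrow> AE u in unif01. 0 \<le> f j u v0"
  using f_pos[OF _ _ v0] by (intro AE_I2) (simp add: less_imp_le)

lemma score_mean:
  assumes j: "j \<ge> 1"
  shows "integrable M (\<lambda>\<omega>. score j (X j \<omega>))" "expectation (\<lambda>\<omega>. score j (X j \<omega>)) = 0"
proof -
  have "integrable (distr M unif01 (X j)) (score j)"
    unfolding law[OF j] using score_mean_unif01[OF j] f_measurable[OF j v0] score_measurable[OF j] f_v0_nonneg[OF j]
    by (simp add: integrable_real_density)
  then show "integrable M (\<lambda>\<omega>. score j (X j \<omega>))"
    by (rule integrable_distr[OF X_measurable[OF j]])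
  have "expectation (\<lambda>\<omega>. score j (X j \<omega>)) = integral\<^sup>L (distr M unif01 (X j)) (score j)"
    by (rule integral_distr[symmetric, OF X_measurable[OF j] score_measurable[OF j]])
  also have "\<dots> = 0"
    unfolding law[OF j] using score_mean_unif01[OF j] f_measurable[OF j v0] score_measurable[OF j] f_v0_nonneg[OF j]
    by (simp add: integral_real_density)
  finally show "expectation (\<lambda>\<omega>. score j (X j \<omega>)) = 0" .
qed

lemma score_square:
  assumes j: "j \<ge> 1"
  shows "integrable M (\<lambda>\<omega>. (score j (X j \<omega>))\<^sup>2)"
    "expectation (\<lambda>\<omega>. (score j (X j \<omega>))\<^sup>2) = fisher_information (f j) v0"
proof -
  have "integrable (distr M unif01 (X j)) (\<lambda>u. (score j u)\<^sup>2)"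
    using regular j unfolding law[OF j] mle_regular_def score_def by blast
  then show "integrable M (\<lambda>\<omega>. (score j (X j \<omega>))\<^sup>2)"
    by (rule integrable_distr[OF X_measurable[OF j]])
  have "expectation (\<lambda>\<omega>. (score j (X j \<omega>))\<^sup>2) = integral\<^sup>L (distr M unif01 (X j)) (\<lambda>u. (score j u)\<^sup>2)"
    using score_measurable[OF j] by (intro integral_distr[symmetric] X_measurable[OF j]) auto
  then show "expectation (\<lambda>\<omega>. (score j (X j \<omega>))\<^sup>2) = fisher_information (f j) v0"
    unfolding law[OF j] fisher_information_def score_def .
qed

text \<open>Independent centred scores are uncorrelated, so their variances add up. The four claims
  go through the induction together because the cross term needs integrability and mean of the
  earlier sum.\<close>

lemma score_sum_moments:
  "integrable M (score_sum n) \<and> expectation (score_sum n) = 0 \<and>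
   integrable M (\<lambda>\<omega>. (score_sum n \<omega>)\<^sup>2) \<and>
   expectation (\<lambda>\<omega>. (score_sum n \<omega>)\<^sup>2) = (\<Sum>j=1..n. fisher_information (f j) v0)"
proof (induction n)
  case 0
  then show ?case by (simp add: score_sum_def[abs_def])
next
  case (Suc n)
  let ?s = "\<lambda>\<omega>. score (Suc n) (X (Suc n) \<omega>)"
  have "indep_vars (\<lambda>_. borel) (\<lambda>j \<omega>. score j (X j \<omega>)) (insert (Suc n) {1..n})"
    by (rule indep_vars_compose2[OF indep_vars_subset[OF indep]]) (auto intro: score_measurable)
  from indep_vars_sum[OF _ _ this]
  have "indep_var borel ?s borel (score_sum n)" by (simp add: score_sum_def[abs_def])
  note cross = indep_var_lebesgue_integral[OF this] indep_var_integrable[OF this]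
  have split: "score_sum (Suc n) = (\<lambda>\<omega>. ?s \<omega> + score_sum n \<omega>)"
    by (simp add: score_sum_def fun_eq_iff)
  have square: "(\<lambda>\<omega>. (score_sum (Suc n) \<omega>)\<^sup>2) = (\<lambda>\<omega>. (?s \<omega>)\<^sup>2 + 2 * (?s \<omega> * score_sum n \<omega>) + (score_sum n \<omega>)\<^sup>2)"
    by (simp add: split power2_sum fun_eq_iff)
  show ?case
    unfolding square unfolding split
    using Suc score_mean[of "Suc n"] score_square[of "Suc n"] cross
    by simp
qed

text \<open>Chebyshev's inequality: the variance is the summed Fisher information, which is
  eventually below \<open>(I + 1) * n\<close>.\<close>

lemma score_sum_tail:
  assumes "\<epsilon> > 0"
  obtains c where "c > 0"
    "\<forall>\<^sub>F n in sequentially. prob {\<omega>\<in>space M. \<bar>score_sum n \<omega>\<bar> \<ge> c * sqrt n} \<le> \<epsilon>"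
proof -
  obtain I where I: "I > 0" "(\<lambda>n. (\<Sum>j=1..n. fisher_information (f j) v0) / real n) \<longlonglongrightarrow> I"
    using regular unfolding mle_regular_def by blast
  \<comment> \<open>Chosen so that the Chebyshev bound \<open>(I + 1) / c\<^sup>2\<close> equals
    \<open>\<epsilon>\<close>.\<close>
  define c where "c = sqrt ((I + 1) / \<epsilon>)"
  have c: "c > 0" "c\<^sup>2 = (I + 1) / \<epsilon>" using I assms by (simp_all add: c_def)
  have "\<forall>\<^sub>F n in sequentially. (\<Sum>j=1..n. fisher_information (f j) v0) / real n < I + 1"
    using I(2) by (rule order_tendstoD) simp
  then have "\<forall>\<^sub>F n in sequentially. prob {\<omega>\<in>space M. \<bar>score_sum n \<omega>\<bar> \<ge> c * sqrt n} \<le> \<epsilon>"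
    using eventually_gt_at_top[of 0]
  proof eventually_elim
    case (elim n)
    have "prob {\<omega>\<in>space M. \<bar>score_sum n \<omega>\<bar> \<ge> c * sqrt n} \<le>
        expectation (\<lambda>\<omega>. (score_sum n \<omega>)\<^sup>2) / (c * sqrt n)\<^sup>2"
      using score_sum_moments[of n] c elim
      by (intro second_moment_method) (auto dest: borel_measurable_integrable)
    also have "\<dots> = ((\<Sum>j=1..n. fisher_information (f j) v0) / n) / c\<^sup>2"
      using score_sum_moments[of n] elim by (simp add: power_mult_distrib)
    also have "\<dots> \<le> (I + 1) / c\<^sup>2"
      using elim by (intro divide_right_mono) auto
    also have "\<dots> = \<epsilon>" using c I assms by simp
    finally show ?case .
  qed
  with c(1) show ?thesis by (rule that)
qed

section \<open>Uniform control of third derivatives\<close>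

text \<open>Markov's inequality for the summed majorants, which are nonnegative at the observations
  and have mean at most \<open>K\<close> each. One \<open>H\<close> is fixed for all tail levels
  \<open>\<epsilon>\<close>.\<close>

lemma third_derivative_tail:
  obtains H where
    "\<And>j u v. j \<ge> 1 \<Longrightarrow> u \<in> {0<..<1} \<Longrightarrow> v \<in> {0<..<1} \<Longrightarrow> \<bar>(deriv ^^ 3) (\<lambda>w. ln (f j u w)) v\<bar> \<le> H j u"
    "\<And>n. (\<lambda>\<omega>. \<Sum>j=1..n. H j (X j \<omega>)) \<in> borel_measurable M"
    "\<And>\<epsilon>. \<epsilon> > 0 \<Longrightarrow> \<exists>c>0. \<forall>n\<ge>1. prob {\<omega>\<in>space M. (\<Sum>j=1..n. H j (X j \<omega>)) \<ge> c * real n} \<le> \<epsilon>"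
proof -
  obtain H K where H: "\<And>j. j \<ge> 1 \<Longrightarrow> integrable (density unif01 (\<lambda>u. ennreal (f j u v0))) (H j)"
    "\<And>j. j \<ge> 1 \<Longrightarrow> (\<integral>u. H j u \<partial>density unif01 (\<lambda>u. ennreal (f j u v0))) \<le> K"
    "\<And>j u v. j \<ge> 1 \<Longrightarrow> u \<in> {0<..<1} \<Longrightarrow> v \<in> {0<..<1} \<Longrightarrow> \<bar>(deriv ^^ 3) (\<lambda>w. ln (f j u w)) v\<bar> \<le> H j u"
  proof -
    have "\<exists>H K. \<forall>j\<ge>1.
        integrable (density unif01 (\<lambda>u. ennreal (f j u v0))) (H j) \<and>
        (\<integral>u. H j u \<partial>density unif01 (\<lambda>u. ennreal (f j u v0))) \<le> K \<and>
        (\<forall>u\<in>{0<..<1}. \<forall>v\<in>{0<..<1}. \<bar>(deriv ^^ 3) (\<lambda>w. ln (f j u w)) v\<bar> \<le> H j u)"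
      using regular unfolding mle_regular_def by (elim conjE)
    then show ?thesis using that by blast
  qed
  have int: "integrable M (\<lambda>\<omega>. H j (X j \<omega>))" and mean: "expectation (\<lambda>\<omega>. H j (X j \<omega>)) \<le> K" if "j \<ge> 1" for j
  proof -
    show "integrable M (\<lambda>\<omega>. H j (X j \<omega>))"
      using H(1)[OF that] unfolding law[OF that, symmetric]
      by (rule integrable_distr[OF X_measurable[OF that]])
    have "H j \<in> borel_measurable unif01"
      using borel_measurable_integrable[OF H(1)[OF that]] by simp
    then have "expectation (\<lambda>\<omega>. H j (X j \<omega>)) = integral\<^sup>L (distr M unif01 (X j)) (H j)"
      by (intro integral_distr[symmetric] X_measurable[OF that])
    then show "expectation (\<lambda>\<omega>. H j (X j \<omega>)) \<le> K" using H(2)[OF that] unfolding law[OF that] by simp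
  qed
  have nonneg: "0 \<le> H j (X j \<omega>)" if "j \<ge> 1" "\<omega> \<in> space M" for j \<omega>
    using H(3)[OF that(1) X_range[OF that] v0] by linarith
  have int_sum: "integrable M (\<lambda>\<omega>. \<Sum>j=1..n. H j (X j \<omega>))" for n
    using int by (intro Bochner_Integration.integrable_sum) auto
  have tail: "\<exists>c>0. \<forall>n\<ge>1. prob {\<omega>\<in>space M. (\<Sum>j=1..n. H j (X j \<omega>)) \<ge> c * real n} \<le> \<epsilon>" if "\<epsilon> > 0" for \<epsilon>
  proof (intro exI conjI allI impI)
    \<comment> \<open>\<open>\<bar>K\<bar> + 1\<close> makes \<open>c\<close> positive whatever the
      sign of \<open>K\<close>.\<close>
    define c where "c = (\<bar>K\<bar> + 1) / \<epsilon>"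
    show c: "c > 0" using that by (simp add: c_def)
    fix n :: nat assume n: "n \<ge> 1"
    have "prob {\<omega>\<in>space M. (\<Sum>j=1..n. H j (X j \<omega>)) \<ge> c * real n} \<le>
        expectation (\<lambda>\<omega>. \<Sum>j=1..n. H j (X j \<omega>)) / (c * real n)"
      using int_sum n c nonneg
      by (intro integral_Markov_inequality_measure[where A = "space M"]) (auto intro!: AE_I2 sum_nonneg)
    also have "expectation (\<lambda>\<omega>. \<Sum>j=1..n. H j (X j \<omega>)) = (\<Sum>j=1..n. expectation (\<lambda>\<omega>. H j (X j \<omega>)))"
      using int by (intro Bochner_Integration.integral_sum) auto
    also have "(\<Sum>j=1..n. expectation (\<lambda>\<omega>. H j (X j \<omega>))) / (c * real n) \<le> (real n * K) / (c * real n)"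
      using c mean sum_bounded_above[of "{1..n}" "\<lambda>j. expectation (\<lambda>\<omega>. H j (X j \<omega>))" K]
      by (intro divide_right_mono) auto
    also have "\<dots> = K / c" using n by simp
    also have "\<dots> \<le> (\<bar>K\<bar> + 1) / c" using c by (intro divide_right_mono) auto
    also have "\<dots> = \<epsilon>" using that by (simp add: c_def)
    finally show "prob {\<omega>\<in>space M. (\<Sum>j=1..n. H j (X j \<omega>)) \<ge> c * real n} \<le> \<epsilon>" .
  qed
  show ?thesis
    using H(3) borel_measurable_integrable[OF int_sum] tail by (rule that)
qed

section \<open>Likelihood ratios and the location of the minimum\<close>

lemma ln_f_measurable:
  assumes "j \<ge> 1" "v \<in> {0<..<1}"
  shows "(\<lambda>\<omega>. ln (f j (X j \<omega>) v)) \<in> borel_measurable M"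
  using measurable_compose[OF X_measurable[OF assms(1)] f_measurable[OF assms]] by measurable

lemma loglik_measurable: "v \<in> {0<..<1} \<Longrightarrow> (\<lambda>\<omega>. loglik n \<omega> v) \<in> borel_measurable M"
  unfolding loglik_def by (intro borel_measurable_sum ln_f_measurable) auto

text \<open>The likelihood ratio has expectation \<open>1\<close> under the true law.\<close>

lemma loglik_ratio_tail:
  assumes v: "v \<in> {0<..<1}"
  shows "prob {\<omega>\<in>space M. loglik n \<omega> v - loglik n \<omega> v0 \<ge> c} \<le> exp (- c)"
proof -
  \<comment> \<open>The value 0 outside the unit interval makes the ratio nonnegative for every
    \<open>u\<close>.\<close>
  define r where "r j u = (if u \<in> {0<..<1} then f j u v / f j u v0 else 0)" for j u
  have r_nonneg: "0 \<le> r j u" if "j \<ge> 1" for j u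
    using f_pos[OF that _ v] f_pos[OF that _ v0] by (auto simp: r_def less_imp_le)
  have r_meas: "r j \<in> borel_measurable unif01" if "j \<ge> 1" for j
  proof -
    have "(\<lambda>u. f j u v / f j u v0) \<in> borel_measurable unif01"
      using f_measurable[OF that v] f_measurable[OF that v0] by measurable
    then show ?thesis by (rule measurable_cong[THEN iffD1, rotated]) (simp add: r_def)
  qed
  have r_mean: "(\<integral>\<^sup>+\<omega>. ennreal (r j (X j \<omega>)) \<partial>M) = 1" if j: "j \<ge> 1" for j
  proof -
    have "(\<integral>\<^sup>+\<omega>. ennreal (r j (X j \<omega>)) \<partial>M) = (\<integral>\<^sup>+u. ennreal (r j u) \<partial>distr M unif01 (X j))"
      using r_meas[OF j] by (intro nn_integral_distr[symmetric] X_measurable[OF j]) auto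
    also have "\<dots> = (\<integral>\<^sup>+u. ennreal (f j u v0) * ennreal (r j u) \<partial>unif01)"
      unfolding law[OF j] using r_meas[OF j] f_measurable[OF j v0] by (intro nn_integral_density) auto
    also have "\<dots> = (\<integral>\<^sup>+u. ennreal (f j u v) \<partial>unif01)"
    proof (rule nn_integral_cong)
      fix u assume "u \<in> space unif01"
      then have u: "u \<in> {0<..<1}" by simp
      have "ennreal (f j u v0) * ennreal (r j u) = ennreal (f j u v0 * r j u)"
        using f_pos[OF j u v0] by (simp add: ennreal_mult' less_imp_le)
      then show "ennreal (f j u v0) * ennreal (r j u) = ennreal (f j u v)"
        using f_pos[OF j u v0] u by (simp add: r_def)
    qed
    also have "\<dots> = 1"
      using copula[OF j] v by (simp add: bivariate_copula_density_def)
    finally show ?thesis .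
  qed
  define R where "R \<omega> = (\<Prod>j=1..n. r j (X j \<omega>))" for \<omega>
  have indep_r: "indep_vars (\<lambda>_. borel) (\<lambda>j \<omega>. r j (X j \<omega>)) {1..n}"
    by (rule indep_vars_compose2[OF indep_vars_subset[OF indep]]) (auto intro: r_meas)
  have R_meas: "R \<in> borel_measurable M"
    unfolding R_def
    by (intro borel_measurable_prod measurable_compose[OF X_measurable r_meas]) auto
  have "(\<integral>\<^sup>+\<omega>. ennreal (R \<omega>) \<partial>M) = (\<integral>\<^sup>+\<omega>. (\<Prod>j=1..n. ennreal (r j (X j \<omega>))) \<partial>M)"
    unfolding R_def using r_nonneg by (intro nn_integral_cong prod_ennreal[symmetric]) auto
  \<comment> \<open>Independence factorises the expectation, and every factor is one.\<close>
  also have "\<dots> = (\<Prod>j=1..n. \<integral>\<^sup>+\<omega>. ennreal (r j (X j \<omega>)) \<partial>M)"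
    by (rule indep_vars_nn_integral[OF _ indep_vars_compose2[OF indep_r]]) auto
  also have "\<dots> = 1" using r_mean by (intro prod.neutral) auto
  finally have nn: "(\<integral>\<^sup>+\<omega>. ennreal (R \<omega>) \<partial>M) = 1" .
  have R_nonneg: "0 \<le> R \<omega>" for \<omega> unfolding R_def using r_nonneg by (intro prod_nonneg) auto
  have int: "integrable M R" using nn R_meas R_nonneg by (intro integrableI_nonneg) auto
  have one: "expectation R = 1" using nn R_meas R_nonneg by (subst integral_eq_nn_integral) auto
  have "R \<omega> = exp (loglik n \<omega> v - loglik n \<omega> v0)" if \<omega>: "\<omega> \<in> space M" for \<omega>
  proof -
    have "exp (loglik n \<omega> v - loglik n \<omega> v0) =
        (\<Prod>j=1..n. exp (ln (f j (X j \<omega>) v) - ln (f j (X j \<omega>) v0)))"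
      unfolding loglik_def sum_subtractf[symmetric] by (rule exp_sum) simp
    also have "\<dots> = R \<omega>"
      unfolding R_def
    proof (rule prod.cong[OF refl])
      fix j assume "j \<in> {1..n}"
      then have j: "j \<ge> 1" by simp
      note X = X_range[OF j \<omega>]
      show "exp (ln (f j (X j \<omega>) v) - ln (f j (X j \<omega>) v0)) = r j (X j \<omega>)"
        using f_pos[OF j X v] f_pos[OF j X v0] X by (simp add: r_def exp_diff)
    qed
    finally show ?thesis by simp
  qed
  then have "{\<omega>\<in>space M. loglik n \<omega> v - loglik n \<omega> v0 \<ge> c} = {\<omega>\<in>space M. R \<omega> \<ge> exp c}"
    by auto
  also have "prob \<dots> \<le> expectation R / exp c"
    using int R_nonneg by (intro integral_Markov_inequality_measure[where A = "space M"]) auto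
  finally show ?thesis using one by (simp add: exp_minus inverse_eq_divide)
qed

text \<open>If the minimum were elsewhere, convergence would make the log-likelihood at
  \<open>vmin\<close> exceed that at \<open>v0\<close> by a multiple of \<open>D\<close> with
  probability above 1/3, against the exponential tail of the likelihood ratio.\<close>

lemma minimizer_eq_true_value:
  fixes d :: "nat \<Rightarrow> nat" and D :: "nat \<Rightarrow> real"
  assumes D: "filterlim D at_top sequentially"
    and conv: "\<And>v. v \<in> {0<..<1} \<Longrightarrow> converges_in_prob M (\<lambda>n \<omega>. - loglik (d n) \<omega> v / D n) (l v)"
    and min: "global_min_at l vmin"
  shows "vmin = v0"
proof (rule ccontr)
  assume "vmin \<noteq> v0"
  then have "\<bar>v0 - vmin\<bar> > 0" by simp
  with min v0 obtain \<eta> where \<eta>: "\<eta> > 0" "l v0 \<ge> l vmin + \<eta>"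
    unfolding global_min_at_def by (meson order_refl)
  have vmin: "vmin \<in> {0<..<1}" using min by (simp add: global_min_at_def)
  let ?A = "\<lambda>n v. {\<omega>\<in>space M. \<bar>- loglik (d n) \<omega> v / D n - l v\<bar> > \<eta> / 4}"
  let ?B = "\<lambda>n. {\<omega>\<in>space M. loglik (d n) \<omega> vmin - loglik (d n) \<omega> v0 \<ge> \<eta> / 2 * D n}"
  have small: "\<forall>\<^sub>F n in sequentially. prob (?A n v) < 1 / 3" if "v \<in> {0<..<1}" for v
  proof (rule order_tendstoD)
    show "(\<lambda>n. prob (?A n v)) \<longlonglongrightarrow> 0"
      using conv[OF that] \<eta>(1) unfolding converges_in_prob_def by (elim conjE allE[of _ "\<eta> / 4"]) simp
  qed simp
  \<comment> \<open>Then \<open>\<eta> / 2 * D n\<close> exceeds 2, and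
    \<open>exp (- 2) \<le> 1 / 3\<close>.\<close>
  have "\<forall>\<^sub>F n in sequentially. D n > 4 / \<eta>" "\<forall>\<^sub>F n in sequentially. D n > 0"
    using D by (simp_all add: filterlim_at_top_dense)
  with small[OF v0] small[OF vmin] have "\<forall>\<^sub>F n in sequentially. False"
  proof eventually_elim
    case (elim n)
    have A_meas: "?A n v \<in> events" if "v \<in> {0<..<1}" for v
      using loglik_measurable[OF that, of "d n"] by measurable
    have B_meas: "?B n \<in> events"
      using loglik_measurable[OF v0, of "d n"] loglik_measurable[OF vmin, of "d n"] by measurable
    note meas = A_meas[OF v0] A_meas[OF vmin] B_meas
    \<comment> \<open>Where both averages are within \<open>\<eta> / 4\<close> of their limits, half
      of the gap \<open>\<eta>\<close> survives, which is the event \<open>?B n\<close>. So the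
      three events cover the space.\<close>
    have "space M \<subseteq> ?A n v0 \<union> ?A n vmin \<union> ?B n"
    proof
      fix \<omega> assume \<omega>: "\<omega> \<in> space M"
      show "\<omega> \<in> ?A n v0 \<union> ?A n vmin \<union> ?B n"
      proof (rule ccontr)
        assume "\<omega> \<notin> ?A n v0 \<union> ?A n vmin \<union> ?B n"
        with \<omega> have "\<bar>- loglik (d n) \<omega> v0 / D n - l v0\<bar> \<le> \<eta> / 4"
          "\<bar>- loglik (d n) \<omega> vmin / D n - l vmin\<bar> \<le> \<eta> / 4"
          and B: "loglik (d n) \<omega> vmin - loglik (d n) \<omega> v0 < \<eta> / 2 * D n" by auto
        then have "\<eta> / 2 \<le> - loglik (d n) \<omega> v0 / D n - - loglik (d n) \<omega> vmin / D n"
          using \<eta>(2) by linarith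
        also have "\<dots> = (loglik (d n) \<omega> vmin - loglik (d n) \<omega> v0) / D n"
          by (simp add: diff_divide_distrib)
        finally show False using B elim by (simp add: pos_le_divide_eq)
      qed
    qed
    then have "prob (space M) \<le> prob (?A n v0 \<union> ?A n vmin \<union> ?B n)"
      by (rule finite_measure_mono) (intro sets.Un meas)
    also have "\<dots> \<le> prob (?A n v0 \<union> ?A n vmin) + prob (?B n)"
      by (intro measure_Un_le sets.Un meas)
    also have "prob (?A n v0 \<union> ?A n vmin) \<le> prob (?A n v0) + prob (?A n vmin)"
      by (intro measure_Un_le meas)
    finally have "1 / 3 < prob (?B n)" using elim prob_space by linarith
    also have "\<dots> \<le> exp (- (\<eta> / 2 * D n))" by (rule loglik_ratio_tail[OF vmin])
    also have "\<dots> \<le> exp (- 2)" using elim \<eta>(1) by (simp add: field_simps)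
    also have "\<dots> \<le> 1 / 3"
      using exp_ge_add_one_self[of 2] by (simp add: exp_minus field_simps)
    finally show False by simp
  qed
  then show False by simp
qed

section \<open>The posterior mean and its rate in probability\<close>

definition posterior_mean :: "nat \<Rightarrow> 'a \<Rightarrow> real" where
  "posterior_mean n \<omega> =
     (\<integral>v. v * (\<Prod>j=1..n. f j (X j \<omega>) v) \<partial>unif01) / (\<integral>v. (\<Prod>j=1..n. f j (X j \<omega>) v) \<partial>unif01)"

lemma posterior_mean_loglik:
  assumes "\<omega> \<in> space M"
  shows "posterior_mean n \<omega> =
     (\<integral>v. v * exp (loglik n \<omega> v) \<partial>unif01) / (\<integral>v. exp (loglik n \<omega> v) \<partial>unif01)"
proof -
  have "(\<Prod>j=1..n. f j (X j \<omega>) v) = exp (loglik n \<omega> v)" if "v \<in> {0<..<1}" for v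
    unfolding loglik_def using f_pos[OF _ X_range[OF _ assms] that]
    by (simp add: exp_sum)
  then show ?thesis
    unfolding posterior_mean_def
    by (intro arg_cong2[where f = "(/)"] Bochner_Integration.integral_cong) auto
qed

lemma posterior_mean_measurable: "posterior_mean n \<in> borel_measurable M"
proof -
  interpret U: prob_space unif01 by (rule prob_space_unif01)
  have "(\<lambda>(\<omega>, v). f j (X j \<omega>) v) \<in> borel_measurable (M \<Otimes>\<^sub>M unif01)" if j: "j \<ge> 1" for j
  proof -
    have "(\<lambda>(\<omega>, v). (X j \<omega>, v)) \<in> measurable (M \<Otimes>\<^sub>M unif01) (unif01 \<Otimes>\<^sub>M unif01)"
      using X_measurable[OF j] by measurable
    from measurable_compose[OF this, of "\<lambda>(u, v). f j u v" borel]
    show ?thesis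
      using copula[OF j] by (simp add: bivariate_copula_density_def split_beta)
  qed
  then have prod: "(\<lambda>p. \<Prod>j=1..n. f j (X j (fst p)) (snd p)) \<in> borel_measurable (M \<Otimes>\<^sub>M unif01)"
    by (intro borel_measurable_prod) (auto simp: split_beta)
  then have den: "(\<lambda>\<omega>. \<integral>v. (\<Prod>j=1..n. f j (X j \<omega>) v) \<partial>unif01) \<in> borel_measurable M"
    by (intro U.borel_measurable_lebesgue_integral) (simp add: split_beta)
  have "(\<lambda>p. snd p) \<in> borel_measurable (M \<Otimes>\<^sub>M unif01)"
    by (rule measurable_compose[OF measurable_snd measurable_unif01_id])
  then have "(\<lambda>p. snd p * (\<Prod>j=1..n. f j (X j (fst p)) (snd p))) \<in> borel_measurable (M \<Otimes>\<^sub>M unif01)"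
    using prod by (rule borel_measurable_times)
  then have num: "(\<lambda>\<omega>. \<integral>v. v * (\<Prod>j=1..n. f j (X j \<omega>) v) \<partial>unif01) \<in> borel_measurable M"
    by (intro U.borel_measurable_lebesgue_integral) (simp add: split_beta)
  show ?thesis
    unfolding posterior_mean_def[abs_def] using num den by (rule borel_measurable_divide)
qed

text \<open>The deterministic bound \<open>posterior_mean_deviation\<close> holds outside three
  exceptional events: a large score, a large third-derivative majorant, or an average log-likelihood
  off its limit at a net point. Each eventually has probability at most
  \<open>\<epsilon> / 3\<close>.\<close>

lemma posterior_mean_rate:
  fixes d :: "nat \<Rightarrow> nat" and D :: "nat \<Rightarrow> real"
  assumes d: "filterlim d at_top sequentially" and dD: "\<And>n. real (d n) \<le> D n"
    and conv: "\<And>v. v \<in> {0<..<1} \<Longrightarrow> converges_in_prob M (\<lambda>n \<omega>. - loglik (d n) \<omega> v / D n) (l v)"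
    and min: "global_min_at l vmin" and convex: "strictly_locally_convex_at l vmin"
  shows "is_bigO_prob M (\<lambda>n \<omega>. posterior_mean (d n) \<omega> - v0) (\<lambda>n. D n powr (- 1 / 2))"
  unfolding is_bigO_prob_def
proof (intro conjI allI impI)
  show "(\<lambda>\<omega>. posterior_mean (d n) \<omega> - v0) \<in> borel_measurable M" for n
    using posterior_mean_measurable by simp
  have "filterlim (\<lambda>n. real (d n)) at_top sequentially"
    using d by (rule filterlim_compose[OF filterlim_real_sequentially])
  then have D: "filterlim D at_top sequentially"
    by (rule filterlim_at_top_mono) (simp add: dD)
  have "vmin = v0" by (rule minimizer_eq_true_value[OF D conv min])
  note min = min[unfolded this] and convex = convex[unfolded this]
  fix \<epsilon> :: real assume "\<epsilon> > 0"
  then have "\<epsilon> / 3 > 0" by simp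
  obtain c where c: "c > 0"
    "\<forall>\<^sub>F n in sequentially. prob {\<omega>\<in>space M. \<bar>score_sum n \<omega>\<bar> \<ge> c * sqrt n} \<le> \<epsilon> / 3"
    using score_sum_tail[OF \<open>\<epsilon> / 3 > 0\<close>] by blast
  obtain H where H:
    "\<And>j u v. j \<ge> 1 \<Longrightarrow> u \<in> {0<..<1} \<Longrightarrow> v \<in> {0<..<1} \<Longrightarrow> \<bar>(deriv ^^ 3) (\<lambda>w. ln (f j u w)) v\<bar> \<le> H j u"
    "\<And>n. (\<lambda>\<omega>. \<Sum>j=1..n. H j (X j \<omega>)) \<in> borel_measurable M"
    "\<And>\<epsilon>. \<epsilon> > 0 \<Longrightarrow> \<exists>k>0. \<forall>n\<ge>1. prob {\<omega>\<in>space M. (\<Sum>j=1..n. H j (X j \<omega>)) \<ge> k * real n} \<le> \<epsilon>"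
  proof (rule third_derivative_tail, goal_cases)
    case (1 H)
    show ?case by (rule that[of H]; fact 1)
  qed
  from H(3)[OF \<open>\<epsilon> / 3 > 0\<close>] obtain k where k: "k > 0"
    "\<And>n. n \<ge> 1 \<Longrightarrow> prob {\<omega>\<in>space M. (\<Sum>j=1..n. H j (X j \<omega>)) \<ge> k * real n} \<le> \<epsilon> / 3"
    by blast
  \<comment> \<open>The net and its tolerance come after \<open>c\<close> and \<open>k\<close>. They
    depend on \<open>\<epsilon>\<close> but not on \<open>n\<close>, so pointwise convergence at
    finitely many points is enough.\<close>
  obtain Q \<delta> B D0 where Q: "finite Q" "Q \<subseteq> {0<..<1}" and \<delta>: "\<delta> > 0" and deviation:
    "\<And>L L' s1 s2 D. D \<ge> D0 \<Longrightarrow>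
       (\<And>v. v \<in> {0<..<1} \<Longrightarrow> (L has_real_derivative L' v) (at v)) \<Longrightarrow>
       (\<And>v. v \<in> {0<..<1} \<Longrightarrow>
          \<bar>L v - L v0 - s1 * (v - v0) - s2 / 2 * (v - v0)\<^sup>2\<bar> \<le> k * D / 6 * \<bar>v - v0\<bar> ^ 3) \<Longrightarrow>
       (\<And>v. v \<in> {0<..<1} \<Longrightarrow> \<bar>L' v - s1 - s2 * (v - v0)\<bar> \<le> k * D / 2 * (v - v0)\<^sup>2) \<Longrightarrow>
       \<bar>s1\<bar> \<le> c * sqrt D \<Longrightarrow>
       (\<And>q. q \<in> Q \<Longrightarrow> \<bar>- L q / D - l q\<bar> \<le> \<delta>) \<Longrightarrow>
       \<bar>(\<integral>v. v * exp (L v) \<partial>unif01) / (\<integral>v. exp (L v) \<partial>unif01) - v0\<bar> \<le> B / sqrt D"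
  proof (rule posterior_mean_deviation[OF min convex less_imp_le[OF c(1)] k(1)], goal_cases)
    case (1 Q \<delta> B D0)
    show ?case by (rule that[of Q \<delta> D0 B]; fact 1)
  qed
  let ?A = "\<lambda>n. {\<omega>\<in>space M. \<bar>score_sum (d n) \<omega>\<bar> \<ge> c * sqrt (d n)}"
  let ?B = "\<lambda>n. {\<omega>\<in>space M. (\<Sum>j=1..d n. H j (X j \<omega>)) \<ge> k * real (d n)}"
  let ?C = "\<lambda>n q. {\<omega>\<in>space M. \<bar>- loglik (d n) \<omega> q / D n - l q\<bar> > \<delta>}"
  have A: "\<forall>\<^sub>F n in sequentially. prob (?A n) \<le> \<epsilon> / 3"
    by (rule eventually_compose_filterlim[OF c(2) d])
  \<comment> \<open>Equal shares for a union bound over \<open>Q\<close>; the added 1 keeps the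
    share positive if \<open>Q\<close> is empty.\<close>
  have "\<forall>\<^sub>F n in sequentially. prob (?C n q) < \<epsilon> / 3 / (card Q + 1)" if "q \<in> Q" for q
  proof (rule order_tendstoD)
    have "q \<in> {0<..<1}" using that Q by auto
    from conv[OF this] show "(\<lambda>n. prob (?C n q)) \<longlonglongrightarrow> 0"
      using \<delta> unfolding converges_in_prob_def by blast
  qed (use \<open>\<epsilon> > 0\<close> in simp)
  then have C: "\<forall>\<^sub>F n in sequentially. \<forall>q\<in>Q. prob (?C n q) < \<epsilon> / 3 / (card Q + 1)"
    by (intro eventually_ball_finite Q(1)) blast
  have "\<forall>\<^sub>F n in sequentially. d n \<ge> 1" using d by (simp add: filterlim_at_top)
  moreover have "\<forall>\<^sub>F n in sequentially. D0 \<le> D n" using D by (simp add: filterlim_at_top)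
  ultimately have "\<forall>\<^sub>F n in sequentially.
      prob {\<omega>\<in>space M. \<bar>posterior_mean (d n) \<omega> - v0\<bar> > B * D n powr (- 1 / 2)} \<le> \<epsilon>"
    using A C
  proof eventually_elim
    case (elim n)
    have Dpos: "D n > 0" using elim(1) dD[of n] by linarith
    have powr: "D n powr (- 1 / 2) = 1 / sqrt (D n)"
      using Dpos by (simp add: powr_minus powr_half_sqrt inverse_eq_divide flip: minus_divide_left)
    \<comment> \<open>Outside the exceptional events the deterministic bound applies with
      \<open>M = c\<close> and \<open>K = k\<close>; bounds in terms of \<open>d n\<close> are
      enlarged to \<open>D n\<close>.\<close>
    have good: "\<bar>posterior_mean (d n) \<omega> - v0\<bar> \<le> B / sqrt (D n)"
      if \<omega>: "\<omega> \<in> space M" "\<omega> \<notin> ?A n" "\<omega> \<notin> ?B n" "\<And>q. q \<in> Q \<Longrightarrow> \<omega> \<notin> ?C n q" for \<omega>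
      unfolding posterior_mean_loglik[OF \<omega>(1)]
    proof (rule deviation[of "D n" _ "\<lambda>v. \<Sum>j=1..d n. deriv (\<lambda>w. ln (f j (X j \<omega>) w)) v"
          "score_sum (d n) \<omega>" "\<Sum>j=1..d n. (deriv ^^ 2) (\<lambda>w. ln (f j (X j \<omega>) w)) v0"])
      let ?S = "\<Sum>j=1..d n. H j (X j \<omega>)"
      have "k * real (d n) \<le> k * D n" using k(1) dD by (intro mult_left_mono) auto
      then have S: "?S \<le> k * D n" using \<omega> by auto
      show "D0 \<le> D n" by fact
      have "c * sqrt (d n) \<le> c * sqrt (D n)" using c(1) dD by (intro mult_left_mono) auto
      then show "\<bar>score_sum (d n) \<omega>\<bar> \<le> c * sqrt (D n)" using \<omega> by auto
      show "\<bar>- loglik (d n) \<omega> q / D n - l q\<bar> \<le> \<delta>" if "q \<in> Q" for q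
        using \<omega>(1) \<omega>(4)[OF that] by auto
      fix v :: real assume v: "v \<in> {0<..<1}"
      have X: "X j \<omega> \<in> {0<..<1}" if "j \<in> {1..d n}" for j
        using X_range \<omega>(1) that by auto
      show "(loglik (d n) \<omega> has_real_derivative (\<Sum>j=1..d n. deriv (\<lambda>w. ln (f j (X j \<omega>) w)) v)) (at v)"
        unfolding loglik_def[abs_def] using ln_f_deriv X v by (intro DERIV_sum) auto
      have T: "\<bar>ln (f j (X j \<omega>) v) - ln (f j (X j \<omega>) v0) - score j (X j \<omega>) * (v - v0)
            - (deriv ^^ 2) (\<lambda>w. ln (f j (X j \<omega>) w)) v0 / 2 * (v - v0)\<^sup>2\<bar> \<le> H j (X j \<omega>) / 6 * \<bar>v - v0\<bar> ^ 3"
        and T': "\<bar>deriv (\<lambda>w. ln (f j (X j \<omega>) w)) v - score j (X j \<omega>)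
            - (deriv ^^ 2) (\<lambda>w. ln (f j (X j \<omega>) w)) v0 * (v - v0)\<bar> \<le> H j (X j \<omega>) / 2 * (v - v0)\<^sup>2"
        if "j \<in> {1..d n}" for j
        using that unfolding score_def
        by (intro C3_on_Taylor[OF C3_ln_f v v0 H(1)] X; simp)+
      \<comment> \<open>The remainder of the sum is the sum of the individual remainders, each
        bounded by its own majorant.\<close>
      have eq: "loglik (d n) \<omega> v - loglik (d n) \<omega> v0 - score_sum (d n) \<omega> * (v - v0)
          - (\<Sum>j=1..d n. (deriv ^^ 2) (\<lambda>w. ln (f j (X j \<omega>) w)) v0) / 2 * (v - v0)\<^sup>2 =
          (\<Sum>j=1..d n. ln (f j (X j \<omega>) v) - ln (f j (X j \<omega>) v0) - score j (X j \<omega>) * (v - v0)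
            - (deriv ^^ 2) (\<lambda>w. ln (f j (X j \<omega>) w)) v0 / 2 * (v - v0)\<^sup>2)"
        by (simp only: loglik_def score_sum_def sum_subtractf sum_distrib_right sum_divide_distrib)
      have "\<bar>loglik (d n) \<omega> v - loglik (d n) \<omega> v0 - score_sum (d n) \<omega> * (v - v0)
          - (\<Sum>j=1..d n. (deriv ^^ 2) (\<lambda>w. ln (f j (X j \<omega>) w)) v0) / 2 * (v - v0)\<^sup>2\<bar>
          \<le> (\<Sum>j=1..d n. H j (X j \<omega>) / 6 * \<bar>v - v0\<bar> ^ 3)" (is "?rem \<le> _")
        unfolding eq using T by (intro order_trans[OF sum_abs] sum_mono)
      also have "\<dots> = ?S / 6 * \<bar>v - v0\<bar> ^ 3"
        by (simp only: sum_distrib_right sum_divide_distrib)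
      also have "\<dots> \<le> k * D n / 6 * \<bar>v - v0\<bar> ^ 3"
        using S by (intro mult_right_mono divide_right_mono) auto
      finally show "?rem \<le> k * D n / 6 * \<bar>v - v0\<bar> ^ 3" .
      have eq': "(\<Sum>j=1..d n. deriv (\<lambda>w. ln (f j (X j \<omega>) w)) v) - score_sum (d n) \<omega>
          - (\<Sum>j=1..d n. (deriv ^^ 2) (\<lambda>w. ln (f j (X j \<omega>) w)) v0) * (v - v0) =
          (\<Sum>j=1..d n. deriv (\<lambda>w. ln (f j (X j \<omega>) w)) v - score j (X j \<omega>)
            - (deriv ^^ 2) (\<lambda>w. ln (f j (X j \<omega>) w)) v0 * (v - v0))"
        by (simp only: score_sum_def sum_subtractf sum_distrib_right)
      have "\<bar>(\<Sum>j=1..d n. deriv (\<lambda>w. ln (f j (X j \<omega>) w)) v) - score_sum (d n) \<omega>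
          - (\<Sum>j=1..d n. (deriv ^^ 2) (\<lambda>w. ln (f j (X j \<omega>) w)) v0) * (v - v0)\<bar>
          \<le> (\<Sum>j=1..d n. H j (X j \<omega>) / 2 * (v - v0)\<^sup>2)" (is "?rem \<le> _")
        unfolding eq' using T' by (intro order_trans[OF sum_abs] sum_mono)
      also have "\<dots> = ?S / 2 * (v - v0)\<^sup>2"
        by (simp only: sum_distrib_right sum_divide_distrib)
      also have "\<dots> \<le> k * D n / 2 * (v - v0)\<^sup>2"
        using S by (intro mult_right_mono divide_right_mono) auto
      finally show "?rem \<le> k * D n / 2 * (v - v0)\<^sup>2" .
    qed
    have A_meas: "?A n \<in> events"
      using borel_measurable_integrable[of M "score_sum (d n)"] score_sum_moments[of "d n"] by simp
    have B_meas: "?B n \<in> events" using H(2)[of "d n"] by simp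
    have C_meas: "?C n q \<in> events" if "q \<in> Q" for q
    proof -
      have "q \<in> {0<..<1}" using that Q by auto
      from loglik_measurable[OF this, of "d n"] show ?thesis by measurable
    qed
    then have UC_meas: "(\<Union>q\<in>Q. ?C n q) \<in> events" using Q(1) by auto
    have "prob (\<Union>q\<in>Q. ?C n q) \<le> (\<Sum>q\<in>Q. prob (?C n q))"
      using Q(1) C_meas by (intro measure_UNION_le) auto
    also have "\<dots> \<le> real (card Q) * (\<epsilon> / 3 / (card Q + 1))"
      using elim(4) by (intro sum_bounded_above) (simp add: less_imp_le)
    also have "\<dots> \<le> \<epsilon> / 3" using \<open>\<epsilon> > 0\<close> by (simp add: field_simps)
    finally have C_small: "prob (\<Union>q\<in>Q. ?C n q) \<le> \<epsilon> / 3" .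
    have "{\<omega>\<in>space M. \<bar>posterior_mean (d n) \<omega> - v0\<bar> > B * D n powr (- 1 / 2)}
        \<subseteq> ?A n \<union> ?B n \<union> (\<Union>q\<in>Q. ?C n q)"
    proof
      fix \<omega> assume "\<omega> \<in> {\<omega>\<in>space M. \<bar>posterior_mean (d n) \<omega> - v0\<bar> > B * D n powr (- 1 / 2)}"
      then have "\<omega> \<in> space M" "\<not> \<bar>posterior_mean (d n) \<omega> - v0\<bar> \<le> B / sqrt (D n)"
        unfolding powr by auto
      with good show "\<omega> \<in> ?A n \<union> ?B n \<union> (\<Union>q\<in>Q. ?C n q)" by blast
    qed
    then have "prob {\<omega>\<in>space M. \<bar>posterior_mean (d n) \<omega> - v0\<bar> > B * D n powr (- 1 / 2)}
        \<le> prob (?A n \<union> ?B n \<union> (\<Union>q\<in>Q. ?C n q))"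
      using A_meas B_meas UC_meas by (intro finite_measure_mono) auto
    also have "\<dots> \<le> prob (?A n \<union> ?B n) + prob (\<Union>q\<in>Q. ?C n q)"
      using A_meas B_meas UC_meas by (intro measure_Un_le) auto
    also have "prob (?A n \<union> ?B n) \<le> prob (?A n) + prob (?B n)"
      using A_meas B_meas by (intro measure_Un_le)
    finally show ?case using elim(3) k(2)[OF elim(1)] C_small by linarith
  qed
  then show "\<exists>B. \<forall>\<^sub>F n in sequentially.
      prob {\<omega>\<in>space M. \<bar>posterior_mean (d n) \<omega> - v0\<bar> > B * D n powr (- 1 / 2)} \<le> \<epsilon>" by blast
qed

end

section \<open>The oblique factor model\<close>

text \<open>Coordinates of a product measure are independent with the factors as laws; selecting the
  row of group \<open>g\<close> preserves this.\<close>

lemma regular_sample_observed_law: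
  assumes model: "oblique_factor_model G cV c"
    and latent: "\<forall>g\<in>{1..G}. v0 g \<in> {0<..<1}"
    and g: "g \<in> {1..G}" and regular: "mle_regular (c g) (v0 g)"
  shows "regular_sample (observed_law G c v0) (\<lambda>j u. u (g, j)) (c g) (v0 g)"
proof -
  let ?K = "{1..G} \<times> {1..}"
  define N where "N = (\<lambda>(g, j). density unif01 (\<lambda>u. ennreal (c g j u (v0 g))))"
  have law_eq: "observed_law G c v0 = PiM ?K N" by (simp add: observed_law_def N_def)
  have copula: "bivariate_copula_density (c h j)" if "h \<in> {1..G}" "j \<ge> 1" for h j
    using model that by (simp add: oblique_factor_model_def)
  have N_prob: "prob_space (N k)" if "k \<in> ?K" for k
    using that latent copula by (auto simp: N_def intro!: prob_space_linking_density)
  have N_sets: "sets (N k) = sets unif01" for k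
    by (simp add: N_def split: prod.split)
  interpret prob_space "PiM ?K N"
    using prob_space_observed_law[OF model latent] by (simp add: law_eq)
  have gj: "(g, j) \<in> ?K" if "j \<ge> 1" for j using g that by auto
  have X: "(\<lambda>u. u (g, j)) \<in> measurable (PiM ?K N) unif01" if "j \<ge> 1" for j
    using measurable_component_singleton[OF gj[OF that], of N]
    by (simp only: measurable_cong_sets[OF refl N_sets])
  have law: "distr (PiM ?K N) unif01 (\<lambda>u. u (g, j)) = N (g, j)" if "j \<ge> 1" for j
  proof -
    have "distr (PiM ?K N) unif01 (\<lambda>u. u (g, j)) = distr (PiM ?K N) (N (g, j)) (\<lambda>u. u (g, j))"
      by (rule distr_cong) (rule refl N_sets[symmetric])+
    also have "\<dots> = N (g, j)" by (rule distr_PiM_component[OF N_prob gj[OF that]])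
    finally show ?thesis .
  qed
  have "indep_vars (\<lambda>_. unif01) (\<lambda>j u. u (g, j)) {1..}"
  proof (rule indep_vars_iff_distr_eq_PiM'[THEN iffD2])
    have "distr (PiM ?K N) (PiM {1..} (\<lambda>_. unif01)) (\<lambda>u. \<lambda>j\<in>{1..}. u (g, j)) =
        distr (PiM ?K N) (PiM {1..} (\<lambda>j. N (g, j))) (\<lambda>u. \<lambda>j\<in>{1..}. u (g, j))"
      by (rule distr_cong) (rule refl sets_PiM_cong N_sets[symmetric])+
    also have "\<dots> = PiM {1..} (\<lambda>j. N (g, j))"
    \<comment> \<open>The injection \<open>Pair g\<close> embeds the indices of one group into all
      indices, so the joint law of the row is again a product.\<close>
    proof (rule distr_PiM_reindex[where f = "Pair g" and M = N and I = "{1..}" and K = ?K])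
      show "inj_on (Pair g) {1..}" by (simp add: inj_on_def)
      show "Pair g \<in> {1..} \<rightarrow> ?K" using g by auto
    qed (rule N_prob)
    also have "\<dots> = PiM {1..} (\<lambda>j. distr (PiM ?K N) unif01 (\<lambda>u. u (g, j)))"
      by (intro PiM_cong refl law[symmetric]) simp
    finally show "distr (PiM ?K N) (PiM {1..} (\<lambda>_. unif01)) (\<lambda>u. \<lambda>j\<in>{1..}. u (g, j)) =
        PiM {1..} (\<lambda>j. distr (PiM ?K N) unif01 (\<lambda>u. u (g, j)))" .
  qed (use X in auto)
  then show ?thesis
    unfolding law_eq
    using law copula[OF g] latent g regular
    by unfold_locales (simp_all add: N_def)
qed

theorem corollary6:
  fixes G :: nat
    and cV :: "(nat \<Rightarrow> real) \<Rightarrow> real"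
    and c :: "nat \<Rightarrow> nat \<Rightarrow> real \<Rightarrow> real \<Rightarrow> real"
    and v0 :: "nat \<Rightarrow> real"
    and d :: "nat \<Rightarrow> nat \<Rightarrow> nat"
  assumes model: "oblique_factor_model G cV c"
    and latent: "\<forall>g\<in>{1..G}. v0 g \<in> {0<..<1}"
    and monotonic: "\<forall>g\<in>{1..G}. \<forall>j\<ge>1. monotonic_dependence (c g j)"
    and regular: "\<forall>g\<in>{1..G}. mle_regular (c g) (v0 g)"
    and dims: "\<forall>g\<in>{1..G}. filterlim (\<lambda>n. d n g) at_top sequentially"
    and no_dominating:
      "\<forall>g\<in>{1..G}. \<exists>\<kappa>>0. \<forall>\<^sub>F n in sequentially. \<kappa> \<le> real (d n g) / real (total_dim G (d n))"
    and limit: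
      "\<forall>g\<in>{1..G}. \<exists>l.
         (\<forall>v\<in>{0<..<1}. converges_in_prob (observed_law G c v0)
                          (\<lambda>n u. avg_neg_loglik G c (d n) g u v) (l v)) \<and>
         (\<exists>vmin. global_min_at l vmin \<and> strictly_locally_convex_at l vmin)"
  shows "\<forall>g\<in>{1..G}.
           is_bigO_prob (observed_law G c v0)
             (\<lambda>n u. proxy c g (d n g) u - v0 g)
             (\<lambda>n. real (total_dim G (d n)) powr (-1/2))"
proof
  fix g assume g: "g \<in> {1..G}"
  \<comment> \<open>Each group is treated separately; its proxy is the posterior mean under the
    uniform prior.\<close>
  interpret regular_sample "observed_law G c v0" "\<lambda>j u. u (g, j)" "c g" "v0 g"
    using regular_sample_observed_law[OF model latent g] regular g by blast
  obtain l vmin where conv: "\<And>v. v \<in> {0<..<1} \<Longrightarrow> converges_in_prob (observed_law G c v0)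
                          (\<lambda>n u. avg_neg_loglik G c (d n) g u v) (l v)"
    and min: "global_min_at l vmin" "strictly_locally_convex_at l vmin"
    using limit g by blast
  \<comment> \<open>This transfers bounds in the group size to the total dimension, in which the
    rate is expressed.\<close>
  have "real (d n g) \<le> real (total_dim G (d n))" for n
    unfolding total_dim_def using g by (intro of_nat_mono member_le_sum) auto
  from posterior_mean_rate[OF _ this _ min] dims g conv
  show "is_bigO_prob (observed_law G c v0) (\<lambda>n u. proxy c g (d n g) u - v0 g)
      (\<lambda>n. real (total_dim G (d n)) powr (-1/2))"
    by (simp add: loglik_def avg_neg_loglik_def proxy_def posterior_mean_def)
qed

end
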